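(* Let $n>1$ be an integer, $1<p<\frac{2n-1}{2(n-1)}$, $0\leq\gamma<2n$, and let $\mu$ be a nonnegative Borel measure on the open unit ball $B\subset\mathbb{C}^n$ satisfying $\int_B(1-|w|^2)^n\,d\mu(w)<\infty$. Let $G_\mu$ be the invariant Green potential of $\mu$ and let $d\lambda(z)=(1-|z|)^n\,d\mu(z)$. Then $$m_p(r,G_\mu)=O\left((1-r)^{\gamma-n}\right),\quad r\uparrow 1,$$ holds if and only if $$\left(\int_S\lambda^p\left(C(\xi,\delta)\right)d\sigma(\xi)\right)^{\frac{1}{p}}=O\left(\delta^\gamma\right),\quad 0<\delta<1.$$
   Context: Notation: $\langle z,w\rangle=\sum_{j=1}^n z_j\overline{w}_j$ and $|z|=\sqrt{\langle z,z\rangle}$ on $\mathbb{C}^n$; $B=\{z\in\mathbb{C}^n:|z|<1\}$; $S=\{z\in\mathbb{C}^n:|z|=1\}$; $\sigma$ is the Lebesgue (rotation-invariant surface) measure on $S$ normalized so that $\sigma(S)=1$. For $z,w\in B$ the involutive automorphism $\varphi_w$ of $B$ is $\varphi_w(z)=\frac{w-P_wz-(1-|w|^2)^{1/2}Q_wz}{1-\langle z,w\rangle}$, where $P_0z=0$, $P_wz=\frac{\langle z,w\rangle}{|w|^2}w$ for $w\neq0$, and $Q_w=I-P_w$. The Green's function for the invariant Laplacian is $G(z,w)=g(\varphi_w(z))$, where $g(z)=\frac{n+1}{2n}\int_{|z|}^1(1-t^2)^{n-1}t^{-2n+1}\,dt$. For a nonnegative Borel measure $\mu$ on $B$ the (invariant)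 Green potential is $G_\mu(z)=\int_B G(z,w)\,d\mu(w)$, $z\in B$ (it is not identically $+\infty$ exactly when $\int_B(1-|w|^2)^n\,d\mu(w)<\infty$). For $0<p<\infty$ and a measurable function $u$ on $B$, $m_p(r,u)=\left(\int_S|u(r\xi)|^p\,d\sigma(\xi)\right)^{1/p}$ for $0<r<1$. For $a,b\in\overline{B}$, $d(a,b)=|1-\langle a,b\rangle|^{1/2}$. For $\xi\in S$ and $\delta>0$, $C(\xi,\delta)=\{z\in B: d(z,\xi)<\delta^{1/2}\}$. The notation $\lambda^p(E)$ means $(\lambda(E))^p$. "$=O(\cdot)$, $0<\delta<1$" means that the bound holds with one constant for all $\delta\in(0,1)$; "$=O(\cdot)$, $r\uparrow1$" means that the bound holds with one constant for all $r<1$ sufficiently close to $1$. *)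

theory Defs
  imports "HOL-Probability.Probability"
begin

definition herm :: "complex ^ 'n \<Rightarrow> complex ^ 'n \<Rightarrow> complex" where
  "herm z w = (\<Sum>j\<in>UNIV. z $ j * cnj (w $ j))"

lemma norm_eq_sqrt_herm: "complex_of_real (norm z) = csqrt (herm z z)"
proof -
  have "herm z z = complex_of_real ((norm z)\<^sup>2)"
    by (simp add: herm_def norm_vec_def L2_set_def sum_nonneg complex_norm_square [symmetric] of_real_sum flip: of_real_power)
  then show ?thesis
    by (simp flip: of_real_sqrt)
qed

text \<open>
  The normalized surface measure on the unit sphere, obtained by projecting normalized Lebesgue
  measure of the unit ball radially onto the sphere (polar coordinates). The facts below show that
  it is the rotation-invariant Borel probability measure.
\<close>

definition sphere_measure :: "'a::euclidean_space measure" where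
  "sphere_measure =
    restrict_space (distr (uniform_measure lborel (ball 0 1)) borel sgn) (sphere 0 1)"

lemma borel_measurable_sgn_vec: "(sgn :: 'a::euclidean_space \<Rightarrow> 'a) \<in> borel_measurable borel"
  unfolding sgn_div_norm by measurable

lemma space_sphere_measure: "space sphere_measure = sphere 0 1"
  by (simp add: sphere_measure_def space_restrict_space)

lemma sets_sphere_measure: "sets sphere_measure = sets (restrict_space borel (sphere 0 1))"
  by (simp add: sphere_measure_def sets_restrict_space)

lemma lborel_ball_pos: "emeasure lborel (ball (0::'a::euclidean_space) 1) \<noteq> 0"
proof
  assume "emeasure lborel (ball (0::'a) 1) = 0"
  then have "negligible (ball (0::'a) 1)"
    by (simp add: negligible_iff_emeasure0)
  then show False
    using negligible_iff_measure[of "ball (0::'a) 1"] content_ball_pos[of 1 "0::'a"] by simp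
qed

lemma prob_space_sphere_measure: "prob_space (sphere_measure :: 'a::euclidean_space measure)"
proof
  let ?U = "uniform_measure lborel (ball 0 1) :: 'a measure"
  interpret U: prob_space ?U
    by (intro prob_space_uniform_measure lborel_ball_pos) (use emeasure_lborel_ball_finite[of "0::'a" 1] in auto)
  have *: "emeasure sphere_measure (space (sphere_measure :: 'a measure))
     = emeasure ?U (sgn -` sphere 0 1)"
    using borel_measurable_sgn_vec
    by (simp add: sphere_measure_def emeasure_restrict_space space_restrict_space emeasure_distr)
  have "AE x in ?U. x \<in> sgn -` sphere 0 1"
  proof (rule AE_uniform_measureI)
    show "AE x in lborel. x \<in> ball 0 1 \<longrightarrow> x \<in> sgn -` sphere (0::'a) 1"
      using AE_lborel_singleton[of 0] by eventually_elim (simp add: norm_sgn)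
  qed simp
  moreover have "sgn -` sphere (0::'a) 1 \<in> sets ?U"
    using measurable_sets[OF borel_measurable_sgn_vec, of "sphere (0::'a) 1"] by simp
  ultimately show "emeasure sphere_measure (space (sphere_measure :: 'a measure)) = 1"
    unfolding * by (intro U.emeasure_eq_1_AE)
qed

lemma distr_lborel_orthogonal:
  fixes U :: "'a::euclidean_space \<Rightarrow> 'a"
  assumes U: "orthogonal_transformation U"
  shows "distr lborel borel U = lborel"
proof (rule measure_eqI)
  fix A :: "'a set" assume "A \<in> sets (distr lborel borel U)"
  then have A [measurable]: "A \<in> sets borel" by simp
  have lin: "linear U" and nU: "norm (U x) = norm x" for x
    using U by (auto simp: orthogonal_transformation)
  have [measurable]: "U \<in> borel_measurable borel"
    using lin by (simp add: borel_measurable_continuous_onI linear_continuous_on linear_conv_bounded_linear)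
  obtain V where V: "U (V y) = y" for y
    using orthogonal_transformation_surj[OF U] by (metis surjD)
  let ?b = "indicator (ball (0::'a) 1) :: 'a \<Rightarrow> ennreal"
  have b [measurable]: "?b \<in> borel_measurable borel"
    by (rule borel_measurable_indicator) simp
  have shift: "(\<integral>\<^sup>+x. f (t + x) \<partial>lborel) = (\<integral>\<^sup>+x. f x \<partial>lborel)"
    if [measurable]: "f \<in> borel_measurable borel" for f :: "'a \<Rightarrow> ennreal" and t
  proof -
    have "(\<integral>\<^sup>+x. f x \<partial>lborel) = (\<integral>\<^sup>+x. f x \<partial>distr lborel borel ((+) t))"
      by (simp add: lborel_distr_plus)
    then show ?thesis
      by (simp add: nn_integral_distr)
  qed
  have "emeasure (distr lborel borel U) A * emeasure lborel (ball (0::'a) 1)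
      = (\<integral>\<^sup>+x. indicator A (U x) \<partial>lborel) * emeasure lborel (ball (0::'a) 1)"
    by (simp add: nn_integral_distr flip: nn_integral_indicator)
  also have "\<dots> = (\<integral>\<^sup>+y. ?b y * (\<integral>\<^sup>+x. indicator A (U x) \<partial>lborel) \<partial>lborel)"
    using b by (subst nn_integral_multc) (auto simp: mult.commute)
  also have "\<dots> = (\<integral>\<^sup>+y. \<integral>\<^sup>+x. ?b y * indicator A (U x + y) \<partial>lborel \<partial>lborel)"
  proof (rule nn_integral_cong)
    fix y
    have "(\<integral>\<^sup>+x. indicator A (U (V y + x)) \<partial>lborel) = (\<integral>\<^sup>+x. indicator A (U x) \<partial>lborel :: ennreal)"
      by (rule shift) measurable
    then show "?b y * (\<integral>\<^sup>+x. indicator A (U x) \<partial>lborel)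
        = (\<integral>\<^sup>+x. ?b y * indicator A (U x + y) \<partial>lborel)"
      by (simp add: nn_integral_cmult linear_add[OF lin] V add.commute)
  qed
  also have "\<dots> = (\<integral>\<^sup>+x. \<integral>\<^sup>+y. ?b y * indicator A (U x + y) \<partial>lborel \<partial>lborel)"
    by (rule lborel_pair.Fubini') measurable
  also have "\<dots> = (\<integral>\<^sup>+x. \<integral>\<^sup>+y. ?b (y - U x) * indicator A y \<partial>lborel \<partial>lborel)"
  proof (rule nn_integral_cong)
    fix x
    show "(\<integral>\<^sup>+y. ?b y * indicator A (U x + y) \<partial>lborel) = (\<integral>\<^sup>+y. ?b (y - U x) * indicator A y \<partial>lborel)"
      using shift[of "\<lambda>y. ?b (y - U x) * indicator A y" "U x"] by simp
  qed
  also have "\<dots> = (\<integral>\<^sup>+y. \<integral>\<^sup>+x. ?b (y - U x) * indicator A y \<partial>lborel \<partial>lborel)"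
    by (rule lborel_pair.Fubini') measurable
  also have "\<dots> = (\<integral>\<^sup>+y. emeasure lborel (ball (0::'a) 1) * indicator A y \<partial>lborel)"
  proof (rule nn_integral_cong)
    fix y
    have "?b (y - U (V y + x)) = ?b x" for x
      by (simp add: linear_add[OF lin] V nU indicator_def)
    then have "(\<integral>\<^sup>+x. ?b (y - U x) \<partial>lborel) = emeasure lborel (ball (0::'a) 1)"
      using shift[of "\<lambda>x. ?b (y - U x)" "V y"] by simp
    then show "(\<integral>\<^sup>+x. ?b (y - U x) * indicator A y \<partial>lborel)
        = emeasure lborel (ball (0::'a) 1) * indicator A y"
      by (simp add: nn_integral_multc)
  qed
  also have "\<dots> = emeasure lborel A * emeasure lborel (ball (0::'a) 1)"
    using A by (subst nn_integral_cmult_indicator) (auto simp: mult.commute)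
  finally show "emeasure (distr lborel borel U) A = emeasure lborel A"
    using lborel_ball_pos emeasure_lborel_ball_finite[of "0::'a" 1]
    by (auto simp: ennreal_mult_cancel_left mult.commute[of _ "emeasure lborel (ball (0::'a) 1)"])
qed simp

lemma sphere_measure_orthogonal:
  fixes U :: "'a::euclidean_space \<Rightarrow> 'a"
  assumes U: "orthogonal_transformation U" and E: "E \<in> sets sphere_measure"
  shows "emeasure sphere_measure (U -` E) = emeasure sphere_measure E"
proof -
  have lin: "linear U" and nU: "norm (U x) = norm x" for x
    using U by (auto simp: orthogonal_transformation)
  have mU [measurable]: "U \<in> borel_measurable borel"
    using lin by (simp add: borel_measurable_continuous_onI linear_continuous_on linear_conv_bounded_linear)
  note [measurable] = borel_measurable_sgn_vec
  have E': "E \<in> sets borel" "E \<subseteq> sphere 0 1"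
    using E by (auto simp: sets_sphere_measure sets_restrict_space_iff)
  note [measurable] = E'(1)
  have UE: "U -` E \<in> sets borel" "U -` E \<subseteq> sphere 0 1"
    using measurable_sets[OF mU E'(1)] E'(2) nU by (auto simp: subset_iff)
  have eq: "emeasure sphere_measure F
      = emeasure lborel (ball 0 1 \<inter> sgn -` F) / emeasure lborel (ball (0::'a) 1)"
    if "F \<in> sets borel" "F \<subseteq> sphere 0 1" for F :: "'a set"
  proof -
    have "sgn -` F \<in> sets borel"
      using measurable_sets[OF borel_measurable_sgn_vec that(1)] by simp
    then show ?thesis
      using that by (simp add: sphere_measure_def emeasure_restrict_space emeasure_distr)
  qed
  have B: "ball 0 1 \<inter> sgn -` E \<in> sets (borel :: 'a measure)"
    using measurable_sets[OF borel_measurable_sgn_vec E'(1)] by auto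
  have "emeasure lborel (ball 0 1 \<inter> sgn -` E) = emeasure (distr lborel borel U) (ball 0 1 \<inter> sgn -` E)"
    by (simp add: distr_lborel_orthogonal[OF U])
  also have "\<dots> = emeasure lborel (U -` (ball 0 1 \<inter> sgn -` E))"
    using B by (simp add: emeasure_distr)
  also have "U -` (ball 0 1 \<inter> sgn -` E) = ball 0 1 \<inter> sgn -` (U -` E)"
    using nU by (auto simp: sgn_div_norm linear_scale[OF lin])
  finally show ?thesis
    by (simp add: eq[OF UE] eq[OF E'])
qed

definition ball_proj :: "complex ^ 'n \<Rightarrow> complex ^ 'n \<Rightarrow> complex ^ 'n" where
  "ball_proj w z = (if w = 0 then 0 else (herm z w / complex_of_real ((norm w)\<^sup>2)) *s w)"

definition ball_aut :: "complex ^ 'n \<Rightarrow> complex ^ 'n \<Rightarrow> complex ^ 'n" where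
  "ball_aut w z = (1 / (1 - herm z w)) *s
     (w - ball_proj w z - sqrt (1 - (norm w)\<^sup>2) *\<^sub>R (z - ball_proj w z))"

text \<open>Extended-valued, so that the pole of the Green's function at the origin has value \<open>\<infinity>\<close>.\<close>

definition green_radial :: "complex ^ 'n \<Rightarrow> ennreal" where
  "green_radial z = ennreal ((real CARD('n) + 1) / (2 * real CARD('n))) *
     (\<integral>\<^sup>+t\<in>{norm z..1}. ennreal ((1 - t\<^sup>2) ^ (CARD('n) - 1) * t powi (1 - 2 * int CARD('n))) \<partial>lborel)"

definition green :: "complex ^ 'n \<Rightarrow> complex ^ 'n \<Rightarrow> ennreal" where
  "green z w = green_radial (ball_aut w z)"

definition green_potential :: "(complex ^ 'n) measure \<Rightarrow> complex ^ 'n \<Rightarrow> ennreal" where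
  "green_potential \<mu> z = (\<integral>\<^sup>+w. green z w \<partial>\<mu>)"

text \<open>Real powers on \<open>[0, \<infinity>]\<close>, used for positive exponents only.\<close>

definition epowr :: "ennreal \<Rightarrow> real \<Rightarrow> ennreal" where
  "epowr x a = (if x = \<infinity> then \<infinity> else ennreal (enn2real x powr a))"

definition sphere_mean :: "real \<Rightarrow> real \<Rightarrow> (complex ^ 'n \<Rightarrow> ennreal) \<Rightarrow> ennreal" where
  "sphere_mean p r u = epowr (\<integral>\<^sup>+\<xi>. epowr (u (r *\<^sub>R \<xi>)) p \<partial>sphere_measure) (1 / p)"

definition nonisotropic_dist :: "complex ^ 'n \<Rightarrow> complex ^ 'n \<Rightarrow> real" where
  "nonisotropic_dist a b = sqrt (cmod (1 - herm a b))"

definition carleson_region :: "complex ^ 'n \<Rightarrow> real \<Rightarrow> (complex ^ 'n) set" where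
  "carleson_region \<xi> \<delta> = {z \<in> ball 0 1. nonisotropic_dist z \<xi> < sqrt \<delta>}"

definition weighted_measure :: "(complex ^ 'n) measure \<Rightarrow> (complex ^ 'n) measure" where
  "weighted_measure \<mu> = density \<mu> (\<lambda>z. ennreal ((1 - norm z) ^ CARD('n)))"

end

theory Submission
  imports Defs
begin

text \<open>
  Put \<open>\<delta> = 1 - r\<close>. On \<open>carleson_region \<xi> \<delta>\<close> the Green's function at \<open>r \<xi>\<close> is at least a constant
  times \<open>\<delta> powr (- n) * (1 - norm w) ^ n\<close>, so the potential dominates \<open>\<delta> powr (- n)\<close> times the
  mass of the region; this gives one direction.

  Conversely the potential is split according to the size of \<open>\<phi>\<^sub>w(r \<xi>)\<close>. Away from the pole the
  Green's function is a dyadic sum over regions of radius \<open>2 ^ k * \<delta>\<close>, which is summable in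
  \<open>L\<^sup>p\<close> because \<open>\<gamma> < 2 n\<close>. Near the pole it behaves like \<open>norm (\<phi>\<^sub>w(r \<xi>)) powr (2 - 2 n)\<close>. There
  Hoelder's inequality and Fubini's theorem reduce the estimate to the integral of
  \<open>norm (\<phi>\<^sub>w(r \<xi>)) powr (- (2 n - 2) p)\<close> over \<open>\<xi>\<close> in a cap of nonisotropic radius comparable to
  \<open>\<delta>\<close>. That integral is \<open>O(\<delta> ^ n)\<close>: after rescaling it is a power singularity of exponent
  \<open>(2 n - 2) p < 2 n - 1\<close> at a point of a manifold of dimension \<open>2 n - 1\<close>.
\<close>

section \<open>Powers on the extended half-line\<close>

text \<open>Near the pole, Hoelder's inequality leaves the factor
  \<open>mass \<xi> (13 * \<delta>)\<close> to the power \<open>p - 1\<close>, which still depends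
  on \<xi>, so Fubini alone does not isolate the kernel. It is therefore replaced by an average over
  the centres \<xi>' whose region of radius \<open>14 * \<delta>\<close> contains w. These regions
  engulf \<open>carleson_region \<xi> (13 * \<delta>)\<close> after enlargement by 18, and the
  centres fill a set of measure at least of order \<delta>^n; the average no longer involves \<xi>.
  The O(\<delta>^n) of the kernel cancels its normalisation, and a second use of Fubini restores the
  p-th power of the mass, at radius \<open>252 * \<delta>\<close>. Rescaling is anisotropic:
  \<delta> in the direction i w / |w|, sqrt \<delta> in the 2 n - 2 complex orthogonal directions.
  \<open>green\<close> enters only through pointwise inequalities; integrals are interchanged for
  explicit majorants. The dyadic regions grow beyond radius 1, where the hypothesis says nothing;
  finite total mass and \<gamma> >= 0 supply this range.\<close>

lemma epowr_ennreal: "0 \<le> x \<Longrightarrow> epowr (ennreal x) a = ennreal (x powr a)"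
  by (simp add: epowr_def)

lemma epowr_top [simp]: "epowr top a = top"
  by (simp add: epowr_def)

lemma epowr_0 [simp]: "epowr 0 a = 0"
  by (simp add: epowr_def)

lemma epowr_one [simp]: "epowr x 1 = x"
  by (cases x) (auto simp: epowr_def)

lemma epowr_eq_0_iff [simp]: "epowr x a = 0 \<longleftrightarrow> x = 0"
  by (cases x) (auto simp: epowr_def ennreal_eq_0_iff powr_def split: if_splits)

lemma epowr_mono:
  assumes "0 \<le> a" "x \<le> y"
  shows "epowr x a \<le> epowr y a"
  using assms by (cases x; cases y) (auto simp: epowr_def powr_mono2 top_unique)

lemma epowr_mult:
  assumes "0 < a"
  shows "epowr (x * y) a = epowr x a * epowr y a"
proof (cases "x = \<infinity> \<or> y = \<infinity>")
  case True
  then show ?thesis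
    by (metis epowr_0 epowr_eq_0_iff epowr_top ennreal_top_mult ennreal_mult_top infinity_ennreal_def mult_zero_left mult_zero_right)
next
  case False
  then obtain a' b' where "0 \<le> a'" "x = ennreal a'" "0 \<le> b'" "y = ennreal b'"
    by (cases x; cases y) auto
  then show ?thesis
    by (simp add: epowr_ennreal powr_mult flip: ennreal_mult)
qed

lemma epowr_add:
  assumes "0 < a" "0 < b"
  shows "epowr x (a + b) = epowr x a * epowr x b"
  using assms by (cases x) (auto simp: epowr_def powr_add ennreal_mult ennreal_top_mult)

lemma epowr_epowr: "epowr (epowr x a) b = epowr x (a * b)"
  by (cases x) (auto simp: epowr_def powr_powr)

lemma epowr_root_le_iff:
  assumes "0 < p" "0 \<le> K"
  shows "epowr x (1 / p) \<le> ennreal K \<longleftrightarrow> x \<le> ennreal (K powr p)"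
proof
  assume "epowr x (1 / p) \<le> ennreal K"
  from epowr_mono[OF _ this, of p] assms show "x \<le> ennreal (K powr p)"
    by (simp add: epowr_epowr epowr_ennreal)
next
  assume "x \<le> ennreal (K powr p)"
  from epowr_mono[OF _ this, of "1 / p"] assms show "epowr x (1 / p) \<le> ennreal K"
    by (simp add: epowr_ennreal powr_powr)
qed

lemma borel_measurable_epowr [measurable (raw)]:
  assumes [measurable]: "f \<in> borel_measurable M"
  shows "(\<lambda>x. epowr (f x) a) \<in> borel_measurable M"
  unfolding epowr_def by measurable

lemma epowr_add_le:
  assumes "0 < p"
  shows "epowr (x + y) p \<le> ennreal (2 powr p) * (epowr x p + epowr y p)"
proof -
  have "epowr (x + y) p \<le> epowr (2 * max x y) p"
    using assms by (intro epowr_mono) (auto simp: mult_2 add_mono)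
  also have "\<dots> = ennreal (2 powr p) * epowr (max x y) p"
    using assms epowr_ennreal[of 2 p] by (simp add: epowr_mult)
  also have "epowr (max x y) p \<le> epowr x p + epowr y p"
    by (simp add: max_def)
  finally show ?thesis
    by (simp add: mult_left_mono)
qed

lemma nn_integral_epowr_cmult:
  assumes "0 < p" "0 \<le> c" and [measurable]: "f \<in> borel_measurable M"
  shows "(\<integral>\<^sup>+x. epowr (ennreal c * f x) p \<partial>M) = ennreal (c powr p) * (\<integral>\<^sup>+x. epowr (f x) p \<partial>M)"
  using assms by (simp add: epowr_mult epowr_ennreal nn_integral_cmult)

text \<open>The tangent to the convex function t powr p at t = c, solved for x. It comes from
  Young's inequality with exponents p and p / (p - 1) for the product of x and c powr (p - 1);
  equality holds at x = c.\<close>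

lemma young_tangent:
  fixes x c p :: real
  assumes "1 < p" "0 < c" "0 \<le> x"
  shows "x \<le> c powr (1 - p) / p * x powr p + (1 - 1 / p) * c"
proof -
  have "x * c powr (p - 1) \<le> x powr p / p + (c powr (p - 1)) powr (p / (p - 1)) / (p / (p - 1))"
    using assms by (intro Youngs_inequality) (auto simp: field_simps)
  also have "(c powr (p - 1)) powr (p / (p - 1)) = c powr p"
    using assms by (simp add: powr_powr)
  finally have "x * c powr (p - 1) * c powr (1 - p) \<le> (x powr p / p + c powr p / (p / (p - 1))) * c powr (1 - p)"
    by (intro mult_right_mono) auto
  also have "x * c powr (p - 1) * c powr (1 - p) = x"
    using assms by (simp add: mult.assoc flip: powr_add)
  also have "(x powr p / p + c powr p / (p / (p - 1))) * c powr (1 - p)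
     = c powr (1 - p) / p * x powr p + (c powr p * c powr (1 - p)) * ((p - 1) / p)"
    by (simp add: field_simps)
  also have "c powr p * c powr (1 - p) = c"
    using assms by (simp flip: powr_add)
  finally show ?thesis
    using assms by (simp add: field_simps)
qed

text \<open>Jensen's inequality, by integrating the tangent to \<open>x powr p\<close> at the power mean of \<open>f\<close>.\<close>

lemma nn_integral_powr_le:
  assumes "1 < p" and [measurable]: "f \<in> borel_measurable M" and fin: "emeasure M (space M) < \<infinity>"
  shows "epowr (\<integral>\<^sup>+x. f x \<partial>M) p
     \<le> epowr (emeasure M (space M)) (p - 1) * (\<integral>\<^sup>+x. epowr (f x) p \<partial>M)"
proof -
  let ?J = "\<integral>\<^sup>+x. epowr (f x) p \<partial>M" and ?m = "emeasure M (space M)"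
  consider "?J = 0" | "?m = 0" | "?m \<noteq> 0" "?J = \<infinity>" | "?m \<noteq> 0" "?J \<noteq> 0" "?J \<noteq> \<infinity>" by blast
  then show ?thesis
  proof cases
    case 1
    then have "AE x in M. f x = 0"
      by (subst (asm) nn_integral_0_iff_AE) auto
    then have "(\<integral>\<^sup>+x. f x \<partial>M) = 0"
      by (subst nn_integral_0_iff_AE) auto
    then show ?thesis by simp
  next
    case 2
    then have "(\<integral>\<^sup>+x. f x \<partial>M) = 0"
      by (simp add: nn_integral_null_set emeasure_eq_0 nn_integral_empty null_sets_def
          nn_integral_0_iff_AE AE_iff_measurable[OF _ refl] emeasure_eq_0[of "space M" M])
    then show ?thesis by simp
  next
    case 3
    then show ?thesis by (simp add: ennreal_mult_top)
  next
    case 4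
    obtain m where m: "?m = ennreal m" "0 < m"
      using fin 4(1) by (cases ?m) (auto simp: less_le)
    obtain j where j: "?J = ennreal j" "0 < j"
      using 4(2,3) by (cases ?J) (auto simp: less_le)
    \<comment> \<open>With m * c powr p = j the two terms of the integrated tangent bound become c *
      m / p and (1 - 1 / p) * c * m, which add up to c * m.\<close>
    define c where "c = (j / m) powr (1 / p)"
    have c: "0 < c" using m j by (simp add: c_def)
    have cp: "c powr p = j / m" using m j assms by (simp add: c_def powr_powr)
    have "f x \<le> ennreal (c powr (1 - p) / p) * epowr (f x) p + ennreal ((1 - 1 / p) * c)" for x
    proof (cases "f x")
      case (real y)
      then show ?thesis
        using young_tangent[OF assms(1) c, of y] assms(1) c
        by (simp add: epowr_ennreal flip: ennreal_mult ennreal_plus)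
    next
      case top
      then show ?thesis using c assms by (simp add: ennreal_mult_top)
    qed
    then have "(\<integral>\<^sup>+x. f x \<partial>M)
        \<le> (\<integral>\<^sup>+x. ennreal (c powr (1 - p) / p) * epowr (f x) p + ennreal ((1 - 1 / p) * c) \<partial>M)"
      by (intro nn_integral_mono)
    also have "\<dots> = ennreal (c powr (1 - p) / p) * ennreal j + ennreal ((1 - 1 / p) * c) * ennreal m"
      by (simp add: nn_integral_add nn_integral_cmult j m)
    also have "\<dots> = ennreal (c powr (1 - p) / p * j + (1 - 1 / p) * c * m)"
      using c assms j m by (simp flip: ennreal_mult ennreal_plus)
    also have "c powr (1 - p) / p * j + (1 - 1 / p) * c * m = c * m"
    proof -
      have "c powr (1 - p) * j = c * m"
        using c m cp by (simp add: powr_diff field_simps)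
      then have "c powr (1 - p) / p * j = c * m / p" by simp
      then show ?thesis by (simp add: algebra_simps)
    qed
    finally have "epowr (\<integral>\<^sup>+x. f x \<partial>M) p \<le> epowr (ennreal (c * m)) p"
      using assms by (intro epowr_mono) auto
    also have "\<dots> = ennreal (m powr (p - 1) * j)"
    proof -
      have "(c * m) powr p = j / m * m powr p"
        using c m cp by (simp add: powr_mult)
      also have "\<dots> = m powr (p - 1) * j"
        using m by (simp add: powr_diff field_simps)
      finally show ?thesis using c m by (simp add: epowr_ennreal)
    qed
    also have "\<dots> = epowr ?m (p - 1) * ?J"
      using m j by (simp add: epowr_ennreal ennreal_mult)
    finally show ?thesis .
  qed
qed

section \<open>The Green's function of the ball\<close>

lemma herm_simps:
  "herm (z + z') w = herm z w + herm z' w"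
  "herm (z - z') w = herm z w - herm z' w"
  "herm (- z) w = - herm z w"
  "herm z (w + w') = herm z w + herm z w'"
  "herm z (w - w') = herm z w - herm z w'"
  "herm (c *s z) w = c * herm z w"
  "herm z (c *s w) = cnj c * herm z w"
  "herm (r *\<^sub>R z) w = complex_of_real r * herm z w"
  "herm z (r *\<^sub>R w) = complex_of_real r * herm z w"
  "herm 0 w = 0" "herm z 0 = 0"
  unfolding herm_def
  by (simp_all add: sum.distrib sum_subtractf sum_negf sum_distrib_left algebra_simps scaleR_conv_of_real[where 'a = complex])

lemma cnj_herm: "cnj (herm z w) = herm w z"
  by (simp add: herm_def mult.commute)

lemma herm_self: "herm z z = complex_of_real ((norm z)\<^sup>2)"
  by (simp add: herm_def norm_vec_def L2_set_def sum_nonneg complex_norm_square [symmetric]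
      of_real_sum flip: of_real_power)

lemma Re_herm: "Re (herm z w) = z \<bullet> w"
  by (simp add: herm_def inner_vec_def inner_complex_def)

lemma norm_smult: "norm (c *s z) = cmod c * norm (z :: complex ^ 'n)"
proof -
  have "complex_of_real ((norm (c *s z))\<^sup>2) = c * cnj c * herm z z"
    by (simp only: herm_simps mult_ac flip: herm_self)
  also have "\<dots> = complex_of_real ((cmod c * norm z)\<^sup>2)"
    unfolding complex_norm_square[symmetric] herm_self by (simp add: power_mult_distrib)
  finally show ?thesis
    by (metis norm_ge_zero mult_nonneg_nonneg of_real_eq_iff power2_eq_imp_eq)
qed

text \<open>The subtracted vector is the orthogonal projection onto the complex line of w. Since the
  real part of \<open>herm\<close> is the real inner product, hermitian orthogonality gives real
  orthogonality, and Pythagoras applies.\<close>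

lemma norm_diff_proj:
  fixes z w :: "complex ^ 'n"
  assumes "w \<noteq> 0"
  shows "(norm (z - (herm z w / complex_of_real ((norm w)\<^sup>2)) *s w))\<^sup>2
    = (norm z)\<^sup>2 - (cmod (herm z w))\<^sup>2 / (norm w)\<^sup>2"
proof -
  define P where "P = (herm z w / complex_of_real ((norm w)\<^sup>2)) *s w"
  have "herm (z - P) P = 0"
    using assms by (simp add: P_def herm_simps herm_self)
  then have "P \<bullet> (z - P) = 0"
    by (metis Re_herm inner_commute zero_complex.simps(1))
  then have "(norm (P + (z - P)))\<^sup>2 = (norm P)\<^sup>2 + (norm (z - P))\<^sup>2"
    by (intro norm_add_Pythagorean) (simp add: orthogonal_def)
  moreover have "norm P = cmod (herm z w) / norm w"
    using assms by (simp add: P_def norm_smult norm_divide norm_mult power2_eq_square)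
  ultimately show ?thesis
    by (simp add: P_def power_divide)
qed

lemma herm_Cauchy_Schwarz: "cmod (herm z w) \<le> norm z * norm (w :: complex ^ 'n)"
proof (cases "w = 0")
  case False
  have "(cmod (herm z w))\<^sup>2 / (norm w)\<^sup>2 \<le> (norm z)\<^sup>2"
    using norm_diff_proj[OF False, of z] zero_le_power2[of "norm (z - (herm z w / complex_of_real ((norm w)\<^sup>2)) *s w)"]
    by linarith
  then have "(cmod (herm z w))\<^sup>2 \<le> (norm z * norm w)\<^sup>2"
    using False by (simp add: field_simps power_mult_distrib)
  then show ?thesis
    by (rule power2_le_imp_le) simp
qed (simp add: herm_simps)

lemma one_minus_herm_ge:
  fixes z w :: "complex ^ 'n"
  assumes "norm z \<le> 1" "norm w \<le> 1"
  shows "1 - norm z \<le> cmod (1 - herm z w)" "1 - norm w \<le> cmod (1 - herm z w)"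
proof -
  have "1 - norm z * norm w \<le> cmod (1 - herm z w)"
    using herm_Cauchy_Schwarz[of z w] norm_triangle_ineq2[of 1 "herm z w"] by simp
  moreover have "norm z * norm w \<le> norm z" "norm z * norm w \<le> norm w"
    using assms by (auto intro: mult_left_le mult_left_le_one_le)
  ultimately show "1 - norm z \<le> cmod (1 - herm z w)" "1 - norm w \<le> cmod (1 - herm z w)"
    by linarith+
qed

text \<open>The numerator of the automorphism splits into a multiple of w and a vector orthogonal to
  w, so Pythagoras gives its squared norm and the square root disappears. Later estimates see
  \<open>ball_aut\<close> only through this identity.\<close>

lemma norm_ball_aut:
  fixes z w :: "complex ^ 'n"
  assumes "norm z < 1" "norm w < 1"
  shows "(norm (ball_aut w z))\<^sup>2
    = 1 - (1 - (norm z)\<^sup>2) * (1 - (norm w)\<^sup>2) / (cmod (1 - herm z w))\<^sup>2"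
proof -
  let ?c = "herm z w"
  have D: "cmod (1 - ?c) > 0"
    using one_minus_herm_ge[of z w] assms by linarith
  define N where "N = w - ball_proj w z - sqrt (1 - (norm w)\<^sup>2) *\<^sub>R (z - ball_proj w z)"
  have w1: "(norm w)\<^sup>2 \<le> 1"
    using assms by (simp add: power_le_one)
  have N: "(norm N)\<^sup>2 = (cmod (1 - ?c))\<^sup>2 - (1 - (norm z)\<^sup>2) * (1 - (norm w)\<^sup>2)"
  proof (cases "w = 0")
    case True
    then show ?thesis by (simp add: N_def ball_proj_def herm_simps)
  next
    case False
    let ?P = "(?c / complex_of_real ((norm w)\<^sup>2)) *s w"
    define A where "A = (1 - ?c / complex_of_real ((norm w)\<^sup>2)) *s w"
    define B where "B = - sqrt (1 - (norm w)\<^sup>2) *\<^sub>R (z - ?P)"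
    have "N = A + B"
      using False by (simp add: N_def A_def B_def ball_proj_def vector_sub_rdistrib)
    moreover have "herm B A = 0"
      using False by (simp add: A_def B_def herm_simps herm_self)
    then have "A \<bullet> B = 0"
      by (metis Re_herm inner_commute zero_complex.simps(1))
    then have "(norm (A + B))\<^sup>2 = (norm A)\<^sup>2 + (norm B)\<^sup>2"
      by (intro norm_add_Pythagorean) (simp add: orthogonal_def)
    moreover have "(norm B)\<^sup>2 = (1 - (norm w)\<^sup>2) * ((norm z)\<^sup>2 - (cmod ?c)\<^sup>2 / (norm w)\<^sup>2)"
      using w1 unfolding norm_diff_proj[OF False, symmetric]
      by (simp add: B_def power_mult_distrib)
    moreover have "(norm A)\<^sup>2 = (norm w)\<^sup>2 - 2 * Re ?c + (cmod ?c)\<^sup>2 / (norm w)\<^sup>2"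
      using False unfolding A_def norm_smult power_mult_distrib cmod_power2
      by (simp add: power2_eq_square field_simps)
    moreover have "(cmod (1 - ?c))\<^sup>2 = 1 - 2 * Re ?c + (cmod ?c)\<^sup>2"
      unfolding cmod_power2 by (simp add: power2_eq_square algebra_simps)
    moreover define X where "X = (cmod ?c)\<^sup>2 / (norm w)\<^sup>2"
    moreover have "(norm w)\<^sup>2 * X = (cmod ?c)\<^sup>2"
      using False by (simp add: X_def)
    ultimately show ?thesis
      unfolding X_def[symmetric] by (simp add: algebra_simps)
  qed
  have "norm (ball_aut w z) = norm N / cmod (1 - ?c)"
    by (simp add: ball_aut_def N_def[symmetric] norm_smult norm_divide)
  then show ?thesis
    using D by (simp add: power_divide N diff_divide_distrib)
qed

text \<open>With t in place of t powi (1 - 2 n) the integrand has the elementary primitive - c (1 -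
  t^2)^n / (2 n). The lower bound and the far upper bound for \<open>green_radial\<close> compare
  with this weight.\<close>

lemma set_nn_integral_green_weight:
  fixes s c :: real
  assumes "0 \<le> s" "s \<le> 1" "0 \<le> c" "0 < n"
  shows "(\<integral>\<^sup>+t\<in>{s..1}. ennreal (c * ((1 - t\<^sup>2) ^ (n - 1) * t)) \<partial>lborel)
    = ennreal (c * (1 - s\<^sup>2) ^ n / (2 * n))"
proof -
  have "(\<integral>\<^sup>+t\<in>{s..1}. ennreal (c * ((1 - t\<^sup>2) ^ (n - 1) * t)) \<partial>lborel)
    = ennreal (- c * (1 - 1\<^sup>2) ^ n / (2 * n) - - c * (1 - s\<^sup>2) ^ n / (2 * n))"
    using assms
    by (intro nn_integral_FTC_Icc) (auto intro!: derivative_eq_intros mult_nonneg_nonneg simp: power_le_one)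
  then show ?thesis
    using assms by (simp add: zero_power)
qed

context
  fixes z :: "complex ^ 'n" and c n :: real
  assumes z: "norm z \<le> 1"
  defines "n \<equiv> real CARD('n)" and "c \<equiv> (n + 1) / (2 * n)"
begin

lemma n_pos: "0 < n" "0 < c"
  by (auto simp: n_def c_def zero_less_card_finite intro!: divide_pos_pos add_pos_pos)

text \<open>On (0, 1] one has t <= t powi (1 - 2 n), the exponent on the right being below
  1.\<close>

lemma green_radial_ge: "green_radial z \<ge> ennreal (c / (2 * n) * (1 - (norm z)\<^sup>2) ^ CARD('n))"
proof -
  have "ennreal (c / (2 * n) * (1 - (norm z)\<^sup>2) ^ CARD('n))
      = ennreal c * ennreal (1 * (1 - (norm z)\<^sup>2) ^ CARD('n) / (2 * n))"
    using n_pos z by (simp add: power_le_one flip: ennreal_mult)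
  also have "\<dots> = ennreal c * (\<integral>\<^sup>+t\<in>{norm z..1}. ennreal (1 * ((1 - t\<^sup>2) ^ (CARD('n) - 1) * t)) \<partial>lborel)"
    using z unfolding n_def by (subst set_nn_integral_green_weight) auto
  also have "\<dots> \<le> green_radial z"
    unfolding green_radial_def c_def n_def
  proof (intro mult_left_mono nn_integral_mono)
    fix t show "ennreal (1 * ((1 - t\<^sup>2) ^ (CARD('n) - 1) * t)) * indicator {norm z..1} t
      \<le> ennreal ((1 - t\<^sup>2) ^ (CARD('n) - 1) * t powi (1 - 2 * int CARD('n))) * indicator {norm z..1} t"
    proof (cases "0 < t \<and> t \<le> 1")
      case True
      have "t \<le> t powi (1 - 2 * int CARD('n))"
        using power_int_decreasing[of "1 - 2 * int CARD('n)" 1 t] True by simp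
      then show ?thesis
        using True by (auto intro!: mult_right_mono ennreal_leI mult_left_mono simp: power_le_one)
    next
      case False
      \<comment> \<open>At t = 0 the negative power takes the default value 0, but the smaller
        integrand also carries a factor t; at all other points of this case the indicator
        vanishes.\<close>
      then show ?thesis
        using norm_ge_zero[of z] by (cases "t = 0") (auto simp: indicator_def simp del: norm_ge_zero)
    qed
  qed auto
  finally show ?thesis .
qed

text \<open>For t >= 1/2 the negative power is t times the n-th power of 1 / t^2, hence at most 4^n
  * t.\<close>

lemma green_radial_le_far:
  assumes "1 / 2 \<le> norm z"
  shows "green_radial z \<le> ennreal (4 ^ CARD('n) * c / (2 * n) * (1 - (norm z)\<^sup>2) ^ CARD('n))"
proof -
  have "green_radial z
      \<le> ennreal c * (\<integral>\<^sup>+t\<in>{norm z..1}. ennreal (4 ^ CARD('n) * ((1 - t\<^sup>2) ^ (CARD('n) - 1) * t)) \<partial>lborel)"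
    unfolding green_radial_def c_def n_def
  proof (intro mult_left_mono nn_integral_mono)
    fix t show "ennreal ((1 - t\<^sup>2) ^ (CARD('n) - 1) * t powi (1 - 2 * int CARD('n))) * indicator {norm z..1} t
      \<le> ennreal (4 ^ CARD('n) * ((1 - t\<^sup>2) ^ (CARD('n) - 1) * t)) * indicator {norm z..1} t"
    proof (cases "norm z \<le> t \<and> t \<le> 1")
      case True
      then have t: "1 / 2 \<le> t" "t \<le> 1" using assms by auto
      obtain k where k: "CARD('n) = Suc k"
        using zero_less_card_finite[where 'a = 'n] gr0_conv_Suc by blast
      have "1 - 2 * int CARD('n) = - int (Suc (2 * k))"
        by (simp add: k)
      then have "t powi (1 - 2 * int CARD('n)) = inverse (t ^ Suc (2 * k))"
        by (simp only: power_int_minus power_int_of_nat)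
      also have "\<dots> = t * inverse (t\<^sup>2) ^ CARD('n)"
        using t by (simp add: k power_inverse power_mult [symmetric]) (simp add: field_simps power2_eq_square)
      also have "inverse (t\<^sup>2) \<le> inverse ((1/2)\<^sup>2)"
        using t by (intro le_imp_inverse_le power_mono) auto
      then have "t * inverse (t\<^sup>2) ^ CARD('n) \<le> t * 4 ^ CARD('n)"
        using t by (intro mult_left_mono power_mono) (auto simp: power2_eq_square)
      finally have "(1 - t\<^sup>2) ^ (CARD('n) - 1) * t powi (1 - 2 * int CARD('n))
          \<le> (1 - t\<^sup>2) ^ (CARD('n) - 1) * (t * 4 ^ CARD('n))"
        using t by (intro mult_left_mono) (auto simp: power_le_one)
      then show ?thesis
        by (intro mult_right_mono ennreal_leI) (auto simp: mult_ac)
    qed (auto simp: indicator_def)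
  qed auto
  also have "\<dots> = ennreal c * ennreal (4 ^ CARD('n) * (1 - (norm z)\<^sup>2) ^ CARD('n) / (2 * n))"
    using z unfolding n_def by (subst set_nn_integral_green_weight) auto
  also have "\<dots> = ennreal (4 ^ CARD('n) * c / (2 * n) * (1 - (norm z)\<^sup>2) ^ CARD('n))"
    using n_pos z by (simp add: power_le_one mult_ac flip: ennreal_mult)
  finally show ?thesis .
qed

text \<open>Bounding (1 - t^2)^(n - 1) by 1 leaves a pure power, whose primitive is again a power
  because n > 1 keeps its exponent away from -1. The inverse is taken in the extended reals, so the
  bound is infinite at z = 0 and covers the pole.\<close>

lemma green_radial_le_near:
  assumes "CARD('n) > 1"
  shows "green_radial z \<le> ennreal c * inverse (ennreal (norm z ^ (2 * CARD('n) - 2)))"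
proof (cases "z = 0")
  case True
  then show ?thesis
    using assms n_pos by (simp add: zero_power ennreal_mult_top)
next
  case False
  define m where "m = 2 * CARD('n) - 2"
  have m: "0 < m" "1 - 2 * int CARD('n) = - int (Suc m)" using assms by (auto simp: m_def of_nat_diff)
  have "green_radial z \<le> ennreal c * (\<integral>\<^sup>+t\<in>{norm z..1}. ennreal (inverse (t ^ Suc m)) \<partial>lborel)"
    unfolding green_radial_def c_def n_def m
  proof (intro mult_left_mono nn_integral_mono)
    fix t show "ennreal ((1 - t\<^sup>2) ^ (CARD('n) - 1) * t powi (- int (Suc m))) * indicator {norm z..1} t
      \<le> ennreal (inverse (t ^ Suc m)) * indicator {norm z..1} t"
    proof (cases "norm z \<le> t \<and> t \<le> 1")
      case True
      then have t: "0 < t" "t \<le> 1" using False by (auto intro: less_le_trans[of 0 "norm z"])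
      have "(1 - t\<^sup>2) ^ (CARD('n) - 1) * inverse (t ^ Suc m) \<le> 1 * inverse (t ^ Suc m)"
        using t by (intro mult_right_mono power_le_one) (auto simp: power_le_one)
      then show ?thesis
        using t by (intro mult_right_mono ennreal_leI) (simp_all add: power_int_minus del: power_Suc of_nat_Suc)
    qed (auto simp: indicator_def)
  qed auto
  also have "(\<integral>\<^sup>+t\<in>{norm z..1}. ennreal (inverse (t ^ Suc m)) \<partial>lborel)
    = ennreal (- inverse (real m) * inverse 1 ^ m - - inverse (real m) * inverse (norm z) ^ m)"
  proof (rule nn_integral_FTC_Icc)
    show "(\<lambda>t::real. inverse (t ^ Suc m)) \<in> borel_measurable borel"
      by measurable
    fix t assume t: "t \<in> {norm z..1}"
    then have "0 < t" using False by (auto intro: less_le_trans[of 0 "norm z"])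
    then have "((\<lambda>t. - inverse (real m) * inverse t ^ m) has_real_derivative
        - inverse (real m) * (real m * (- (inverse t * 1 * inverse t) * inverse t ^ (m - Suc 0)))) (at t)"
      by (auto intro!: derivative_eq_intros)
    moreover have "- inverse (real m) * (real m * (- (inverse t * 1 * inverse t) * inverse t ^ (m - Suc 0))) = inverse t ^ Suc m"
      using m(1) by (cases m) (simp_all del: of_nat_Suc add: power_inverse)
    ultimately show "((\<lambda>t. - inverse (real m) * inverse t ^ m) has_real_derivative inverse (t ^ Suc m)) (at t)"
      by (simp only: power_inverse)
    show "0 \<le> inverse (t ^ Suc m)" using \<open>0 < t\<close> by simp
  qed (rule z)
  also have "\<dots> \<le> ennreal (inverse (norm z ^ m))"
  proof (rule ennreal_leI)
    have "inverse (real m) * inverse (norm z ^ m) \<le> 1 * inverse (norm z ^ m)"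
      using m by (intro mult_right_mono) (auto simp: inverse_le_1_iff)
    then show "- inverse (real m) * inverse 1 ^ m - - inverse (real m) * inverse (norm z) ^ m \<le> inverse (norm z ^ m)"
      by (simp add: power_inverse diff_le_eq add_increasing2)
  qed
  also have "ennreal (inverse (norm z ^ m)) = inverse (ennreal (norm z ^ m))"
    using False by (simp add: inverse_ennreal)
  finally show ?thesis
    by (simp add: mult_left_mono m_def)
qed

end

section \<open>Integrals over the sphere\<close>

text \<open>The sphere measure pushes normalised volume forward along \<open>sgn\<close>, so a
  function on the sphere is integrated as its radial extension over the ball. The factor with
  \<open>sphere 0 1\<close> only excludes the origin, where \<open>sgn\<close> is 0.\<close>

lemma nn_integral_sphere_measure:
  fixes f :: "'a::euclidean_space \<Rightarrow> ennreal"
  assumes [measurable]: "f \<in> borel_measurable borel"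
  shows "(\<integral>\<^sup>+\<xi>. f \<xi> \<partial>sphere_measure) =
    (\<integral>\<^sup>+x. f (sgn x) * indicator (sphere 0 1) (sgn x) * indicator (ball 0 1) x \<partial>lborel)
      / emeasure lborel (ball (0::'a) 1)"
proof -
  note [measurable] = borel_measurable_sgn_vec
  have [measurable]: "sphere (0::'a) 1 \<in> sets borel" "ball (0::'a) 1 \<in> sets borel"
    by auto
  show ?thesis
    unfolding sphere_measure_def
    by (simp add: nn_integral_restrict_space nn_integral_distr nn_integral_uniform_measure)
qed

lemma nn_integral_sphere_measure_orthogonal:
  fixes f :: "'a::euclidean_space \<Rightarrow> ennreal" and U :: "'a \<Rightarrow> 'a"
  assumes U: "orthogonal_transformation U" and [measurable]: "f \<in> borel_measurable borel"
  shows "(\<integral>\<^sup>+\<xi>. f (U \<xi>) \<partial>sphere_measure) = (\<integral>\<^sup>+\<xi>. f \<xi> \<partial>sphere_measure)"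
proof -
  note [measurable] = borel_measurable_sgn_vec
  have [measurable]: "sphere (0::'a) 1 \<in> sets borel" "ball (0::'a) 1 \<in> sets borel"
    by auto
  have lin: "linear U" and nU: "norm (U x) = norm x" for x
    using U by (auto simp: orthogonal_transformation)
  have [measurable]: "U \<in> borel_measurable borel"
    using lin by (simp add: borel_measurable_continuous_onI linear_continuous_on linear_conv_bounded_linear)
  have sgn: "sgn (U x) = U (sgn x)" for x
    by (simp add: sgn_div_norm nU linear_scale[OF lin])
  let ?g = "\<lambda>x. f (sgn x) * indicator (sphere 0 1) (sgn x) * indicator (ball 0 1) x"
  have "(\<integral>\<^sup>+x. ?g x \<partial>lborel) = (\<integral>\<^sup>+x. ?g x \<partial>distr lborel borel U)"
    by (simp add: distr_lborel_orthogonal[OF U])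
  also have "\<dots> = (\<integral>\<^sup>+x. ?g (U x) \<partial>lborel)"
    by (simp add: nn_integral_distr)
  also have "\<dots> = (\<integral>\<^sup>+x. f (U (sgn x)) * indicator (sphere 0 1) (sgn x) * indicator (ball 0 1) x \<partial>lborel)"
    by (intro nn_integral_cong) (auto simp: sgn nU indicator_def)
  finally show ?thesis
    by (simp add: nn_integral_sphere_measure)
qed

text \<open>The Householder reflection across the hyperplane orthogonal to a - b (the identity if a
  = b). The last property allows a second reflection to leave the effect of a first one
  intact.\<close>

lemma reflection_exists:
  fixes a b :: "'a::euclidean_space"
  assumes "norm a = norm b"
  obtains T where "orthogonal_transformation T" "T a = b" "\<And>x. x \<bullet> a = x \<bullet> b \<Longrightarrow> T x = x"
proof -
  define v where "v = a - b"
  let ?T = "\<lambda>x. x - (2 * (x \<bullet> v) / (v \<bullet> v)) *\<^sub>R v"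
  have "a \<bullet> a = b \<bullet> b"
    using assms by (simp add: dot_square_norm)
  then have v: "v \<bullet> v = 2 * (a \<bullet> v)"
    by (simp add: v_def inner_diff_left inner_diff_right inner_commute)
  have "orthogonal_transformation ?T"
    unfolding orthogonal_transformation
  proof
    show "linear ?T"
      by (rule linearI) (simp_all add: inner_add_left algebra_simps add_divide_distrib)
    have "?T x \<bullet> ?T x = x \<bullet> x" for x
    proof (cases "v = 0")
      case False
      then have "v \<bullet> v \<noteq> 0" by simp
      moreover have "?T x \<bullet> ?T x = x \<bullet> x - 2 * (2 * (x \<bullet> v) / (v \<bullet> v)) * (x \<bullet> v)
          + (2 * (x \<bullet> v) / (v \<bullet> v)) * (2 * (x \<bullet> v) / (v \<bullet> v)) * (v \<bullet> v)"
        unfolding inner_diff_left[of x] inner_diff_right[of _ x] inner_scaleR_left inner_scaleR_right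
        by (simp add: inner_commute algebra_simps)
      ultimately show ?thesis by simp
    qed simp
    then show "\<forall>x. norm (?T x) = norm x"
      by (simp add: norm_eq_sqrt_inner)
  qed
  moreover have "?T a = b"
    using v by (cases "v = 0") (auto simp: v_def)
  moreover have "?T x = x" if "x \<bullet> a = x \<bullet> b" for x
    using that by (simp add: v_def inner_diff_right)
  ultimately show ?thesis
    by (rule that)
qed

text \<open>Two reflections suffice: the first takes a to e1; the second takes the image of b to e2
  and fixes e1, because e1 is orthogonal to both vectors.\<close>

lemma nn_integral_sphere_inner2:
  fixes a b e1 e2 :: "'a::euclidean_space" and F :: "real \<Rightarrow> real \<Rightarrow> ennreal"
  assumes ab: "norm a = 1" "norm b = 1" "a \<bullet> b = 0"
    and e: "norm e1 = 1" "norm e2 = 1" "e1 \<bullet> e2 = 0"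
    and [measurable]: "case_prod F \<in> borel_measurable (borel \<Otimes>\<^sub>M borel)"
  shows "(\<integral>\<^sup>+\<xi>. F (\<xi> \<bullet> a) (\<xi> \<bullet> b) \<partial>sphere_measure) = (\<integral>\<^sup>+\<xi>. F (\<xi> \<bullet> e1) (\<xi> \<bullet> e2) \<partial>sphere_measure)"
proof -
  obtain T1 where T1: "orthogonal_transformation T1" "T1 a = e1"
    using reflection_exists[of a e1] ab e by metis
  have in1: "T1 x \<bullet> T1 y = x \<bullet> y" for x y
    using T1 by (simp add: orthogonal_transformation_def)
  then have Tb: "norm (T1 b) = norm e2" "e1 \<bullet> T1 b = 0"
    using ab e by (simp_all add: norm_eq_sqrt_inner) (metis T1(2) in1)
  obtain T2 where T2: "orthogonal_transformation T2" "T2 (T1 b) = e2" "T2 e1 = e1"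
    using reflection_exists[OF Tb(1)] Tb(2) e(3) by metis
  define U where "U = T2 \<circ> T1"
  have U: "orthogonal_transformation U" "U a = e1" "U b = e2"
    using T1 T2 by (simp_all add: U_def orthogonal_transformation_compose)
  then have inU: "U x \<bullet> e1 = x \<bullet> a" "U x \<bullet> e2 = x \<bullet> b" for x
    by (metis orthogonal_transformation_def)+
  have "(\<integral>\<^sup>+\<xi>. F (U \<xi> \<bullet> e1) (U \<xi> \<bullet> e2) \<partial>sphere_measure) = (\<integral>\<^sup>+\<xi>. F (\<xi> \<bullet> e1) (\<xi> \<bullet> e2) \<partial>sphere_measure)"
    by (rule nn_integral_sphere_measure_orthogonal[OF U(1)]) measurable
  then show ?thesis
    by (simp add: inU)
qed

section \<open>Spherical estimates in Cartesian coordinates\<close>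

lemma nn_integral_abs_powr_neg_finite:
  fixes q :: real
  assumes "0 \<le> q" "q < 1"
  shows "(\<integral>\<^sup>+y. inverse (ennreal (\<bar>y\<bar> powr q)) * indicator {-1..1} y \<partial>lborel) < \<infinity>"
proof -
  let ?h = "\<lambda>y::real. ennreal (y powr - q) * indicator {0..1} y"
  have *: "integral\<^sup>N lborel ?h = ennreal (1 powr (- q + 1) / (- q + 1))"
    using assms by (intro nn_integral_has_integral_lebesgue' has_integral_powr_from_0) auto
  have [measurable]: "?h \<in> borel_measurable borel" by measurable
  have "(\<integral>\<^sup>+y. inverse (ennreal (\<bar>y\<bar> powr q)) * indicator {-1..1} y \<partial>lborel)
    \<le> (\<integral>\<^sup>+y. ?h y + ?h (0 + (-1) * y) \<partial>lborel)"
  proof (rule nn_integral_mono_AE)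
    \<comment> \<open>At 0 the left side is infinite while \<open>0 powr - q\<close> has the default
      value 0, so the bound holds only almost everywhere.\<close>
    show "AE y::real in lborel. inverse (ennreal (\<bar>y\<bar> powr q)) * indicator {-1..1} y \<le> ?h y + ?h (0 + (-1) * y)"
      using AE_lborel_singleton[of "0::real"]
      by eventually_elim (auto simp: indicator_def inverse_ennreal powr_minus abs_if)
  qed
  also have "\<dots> = integral\<^sup>N lborel ?h + (\<integral>\<^sup>+y. ?h (0 + (-1) * y) \<partial>lborel)"
    by (intro nn_integral_add) measurable
  also have "(\<integral>\<^sup>+y. ?h (0 + (-1) * y) \<partial>lborel) = integral\<^sup>N lborel ?h"
    using nn_integral_real_affine[of ?h "-1" 0] by simp
  finally show ?thesis
    unfolding * by (simp add: less_top[symmetric]) (metis ennreal_add_eq_top ennreal_neq_top neq_top_trans)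
qed

lemma ennreal_inverse_antimono:
  fixes x y :: ennreal
  assumes "x \<le> y"
  shows "inverse y \<le> inverse x"
proof (cases "x = 0 \<or> y = top")
  case False
  then obtain a b where "x = ennreal a" "y = ennreal b" "0 < a" "0 < b"
    using assms by (cases x; cases y) (auto simp: less_le top_unique)
  then show ?thesis
    using assms by (simp add: inverse_ennreal)
qed auto

text \<open>Singularities in the coordinates of \<open>sgn x\<close> are thus dominated by the same
  singularities in the coordinates of x, to which a product of one-dimensional integrals
  applies.\<close>

lemma inner_sgn_abs_ge:
  fixes x b :: "'a::euclidean_space"
  assumes "norm x \<le> 1"
  shows "\<bar>x \<bullet> b\<bar> \<le> \<bar>sgn x \<bullet> b\<bar>"
proof -
  have "x = norm x *\<^sub>R sgn x"
    by (cases "x = 0") (simp_all add: sgn_div_norm)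
  then have "\<bar>x \<bullet> b\<bar> = norm x * \<bar>sgn x \<bullet> b\<bar>"
    by (metis abs_mult abs_norm_cancel inner_scaleR_left)
  then show ?thesis
    using assms by (simp add: mult_left_le_one_le)
qed

lemma sum_inner_Basis_square: "(norm (x::'a::euclidean_space))\<^sup>2 = (\<Sum>b\<in>Basis. (x \<bullet> b)\<^sup>2)"
  unfolding power2_norm_eq_inner euclidean_inner[of x x] by (simp add: power2_eq_square)

text \<open>Here x and y are the real and imaginary parts of the component of a unit vector along a
  complex line, and 1 - x^2 - y^2 is the squared length of the rest. The length l1 scales the
  tangential direction inside that line, l2 the complex orthogonal ones; with l1 of order \<delta>
  and l2 of order sqrt \<delta>, \<delta> small, the support is a nonisotropic cap together with its
  antipode.\<close>

definition singular_profile :: "real \<Rightarrow> real \<Rightarrow> real \<Rightarrow> real \<Rightarrow> real \<Rightarrow> ennreal" where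
  "singular_profile l1 l2 a x y = (if \<bar>y\<bar> \<le> l1 \<and> 1 - x\<^sup>2 - y\<^sup>2 \<le> l2\<^sup>2
     then inverse (ennreal (((y / l1)\<^sup>2 + (1 - x\<^sup>2 - y\<^sup>2) / l2\<^sup>2) powr a)) else 0)"

text \<open>The base of the power dominates the square of each rescaled coordinate other than \<open>e1\<close>;
  splitting the exponent evenly over these \<open>DIM('a) - 1\<close> coordinates bounds the integrand by a
  product of one-dimensional integrable singularities.\<close>

lemma sphere_singular_integral:
  fixes e1 e2 :: "'a::euclidean_space" and a :: real
  assumes e: "e1 \<in> Basis" "e2 \<in> Basis" "e1 \<noteq> e2" and a: "0 < a" "2 * a < DIM('a) - 1"
  obtains A :: real where "0 \<le> A"
    "\<And>l1 l2. 0 < l1 \<Longrightarrow> 0 < l2 \<Longrightarrow>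
      (\<integral>\<^sup>+\<xi>. singular_profile l1 l2 a (\<xi> \<bullet> e1) (\<xi> \<bullet> e2) \<partial>sphere_measure) \<le> ennreal (A * l1 * l2 ^ (DIM('a) - 2))"
proof -
  define m where "m = DIM('a) - 1"
  have card1: "card (Basis - {e1}) = m"
    using e by (simp add: m_def)
  have card2: "card (Basis - {e1} - {e2}) = DIM('a) - 2"
    using e by simp
  have "card {e1, e2} \<le> DIM('a)"
    using e by (intro card_mono) auto
  then have m: "0 < m" "real m = DIM('a) - 1"
    using e by (auto simp: m_def)
  \<comment> \<open>The exponent of each of the m one-dimensional factors; the upper bound on a is
    exactly q < 1.\<close>
  define q where "q = 2 * a / m"
  have q: "0 < q" "q < 1"
    using a m by (auto simp: q_def)
  let ?h = "\<lambda>y::real. inverse (ennreal (\<bar>y\<bar> powr q)) * indicator {-1..1} y"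
  have [measurable]: "?h \<in> borel_measurable borel" by measurable
  obtain H where H: "0 \<le> H" "(\<integral>\<^sup>+y. ?h y \<partial>lborel) = ennreal H"
    using nn_integral_abs_powr_neg_finite[of q] q by (cases "\<integral>\<^sup>+y. ?h y \<partial>lborel") auto
  obtain V where V: "0 < V" "emeasure lborel (ball (0::'a) 1) = ennreal V"
    using lborel_ball_pos[where 'a = 'a] emeasure_lborel_ball_finite[of "0::'a" 1]
    by (cases "emeasure lborel (ball (0::'a) 1)") (auto simp: less_le)
  show ?thesis
  proof (rule that[of "2 * H ^ m / V"])
    show "0 \<le> 2 * H ^ m / V" using H V by simp
    fix l1 l2 :: real assume l: "0 < l1" "0 < l2"
    define t where "t = (\<lambda>\<xi>::'a. 1 - (\<xi> \<bullet> e1)\<^sup>2 - (\<xi> \<bullet> e2)\<^sup>2)"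
    define Q where "Q = (\<lambda>\<xi>. (\<xi> \<bullet> e2 / l1)\<^sup>2 + t \<xi> / l2\<^sup>2)"
    define \<Psi> where "\<Psi> = (\<lambda>\<xi>. if \<bar>\<xi> \<bullet> e2\<bar> \<le> l1 \<and> t \<xi> \<le> l2\<^sup>2 then inverse (ennreal (Q \<xi> powr a)) else 0)"
    define l where "l = (\<lambda>b. if b = e2 then l1 else l2)"
    have l_pos: "0 < l b" for b using l by (simp add: l_def)
    \<comment> \<open>The coordinate along e1 carries only a cutoff, whose integral is the factor 2.
      The shape \<open>0 + (1 / l b) * y\<close> is that of the affine change of variable used
      below.\<close>
    define f where "f = (\<lambda>b y. if b = e1 then indicator {-1..1} y else ?h (0 + (1 / l b) * y))"
    have [measurable]: "\<Psi> \<in> borel_measurable borel"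
      unfolding \<Psi>_def Q_def t_def by measurable
    have [measurable]: "f b \<in> borel_measurable borel" for b
      unfolding f_def by (cases "b = e1") simp_all
    have pt: "\<Psi> (sgn x) * indicator (sphere 0 1) (sgn x) * indicator (ball 0 1) x
        \<le> (\<Prod>b\<in>Basis. f b (x \<bullet> b))" for x :: 'a
    proof (cases "\<bar>sgn x \<bullet> e2\<bar> \<le> l1 \<and> t (sgn x) \<le> l2\<^sup>2 \<and> sgn x \<in> sphere 0 1 \<and> x \<in> ball 0 1")
      case True
      define \<xi> where "\<xi> = sgn x"
      have \<xi>: "\<bar>\<xi> \<bullet> e2\<bar> \<le> l1" "t \<xi> \<le> l2\<^sup>2" "norm \<xi> = 1" "norm x < 1"
        using True by (auto simp: \<xi>_def)
      have t: "(\<xi> \<bullet> b)\<^sup>2 \<le> t \<xi>" if "b \<in> Basis" "b \<noteq> e1" "b \<noteq> e2" for b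
      proof -
        have "(\<Sum>b\<in>{e1, e2, b}. (\<xi> \<bullet> b)\<^sup>2) \<le> (norm \<xi>)\<^sup>2"
          unfolding sum_inner_Basis_square using that e by (intro sum_mono2) auto
        then show ?thesis using \<xi>(3) e that by (simp add: t_def)
      qed
      have t0: "0 \<le> t \<xi>"
      proof -
        have "(\<Sum>b\<in>{e1, e2}. (\<xi> \<bullet> b)\<^sup>2) \<le> (norm \<xi>)\<^sup>2"
          unfolding sum_inner_Basis_square using e by (intro sum_mono2) auto
        then show ?thesis using \<xi>(3) e by (simp add: t_def)
      qed
      have lb: "\<bar>\<xi> \<bullet> b\<bar> \<le> l b" and Qb: "(\<xi> \<bullet> b / l b)\<^sup>2 \<le> Q \<xi>" if "b \<in> Basis" "b \<noteq> e1" for b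
      proof -
        show "\<bar>\<xi> \<bullet> b\<bar> \<le> l b"
        proof (cases "b = e2")
          case False
          then have "(\<xi> \<bullet> b)\<^sup>2 \<le> l2\<^sup>2" using t[OF that] \<xi>(2) by linarith
          then show ?thesis
            using False l by (simp add: l_def abs_le_square_iff[symmetric])
        qed (use \<xi>(1) in \<open>simp add: l_def\<close>)
        show "(\<xi> \<bullet> b / l b)\<^sup>2 \<le> Q \<xi>"
        proof (cases "b = e2")
          case True
          then show ?thesis using t0 by (simp add: Q_def l_def)
        next
          case False
          then have "(\<xi> \<bullet> b)\<^sup>2 / l2\<^sup>2 \<le> t \<xi> / l2\<^sup>2"
            using t[OF that] by (intro divide_right_mono) auto
          then show ?thesis
            using False by (simp add: Q_def l_def power_divide add_increasing)
        qed
      qed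
      have "inverse (ennreal (Q \<xi> powr a)) = inverse (ennreal (Q \<xi> powr (a / m)) ^ m)"
      proof (cases "Q \<xi> = 0")
        case False
        then show ?thesis
          using m by (simp add: ennreal_power powr_realpow[symmetric] powr_powr)
      qed (use m in \<open>simp add: zero_power\<close>)
      also have "\<dots> = (\<Prod>b\<in>Basis - {e1}. inverse (ennreal (Q \<xi> powr (a / m))))"
        by (simp add: card1 ennreal_inverse_power)
      also have "\<dots> \<le> (\<Prod>b\<in>Basis - {e1}. f b (x \<bullet> b))"
      proof (rule prod_mono_ennreal)
        fix b assume "b \<in> Basis - {e1}"
        then have b: "b \<in> Basis" "b \<noteq> e1" by auto
        have xb: "\<bar>x \<bullet> b / l b\<bar> \<le> \<bar>\<xi> \<bullet> b / l b\<bar>"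
          using inner_sgn_abs_ge[of x b] \<xi>(4) l_pos[of b] by (simp add: \<xi>_def divide_right_mono)
        have "\<bar>x \<bullet> b / l b\<bar> powr q \<le> \<bar>\<xi> \<bullet> b / l b\<bar> powr q"
          using xb q by (intro powr_mono2) auto
        also have "\<dots> = ((\<xi> \<bullet> b / l b)\<^sup>2) powr (a / m)"
        proof -
          have "\<bar>y\<bar> powr (2 * c) = y\<^sup>2 powr c" for y c :: real
            using powr_powr[of "\<bar>y\<bar>" 2 c] by (cases "y = 0") simp_all
          from this[of "\<xi> \<bullet> b / l b" "a / m"] show ?thesis
            by (simp add: q_def del: abs_divide)
        qed
        also have "\<dots> \<le> Q \<xi> powr (a / m)"
          using Qb[OF b] a by (intro powr_mono2) auto
        finally have "inverse (ennreal (Q \<xi> powr (a / m))) \<le> inverse (ennreal (\<bar>x \<bullet> b / l b\<bar> powr q))"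
          by (intro ennreal_inverse_antimono ennreal_leI)
        moreover have "\<bar>x \<bullet> b / l b\<bar> \<le> 1"
          using xb lb[OF b] l_pos[of b] by (simp add: field_simps)
        then have "indicator {-1..1} (x \<bullet> b / l b) = (1::ennreal)"
          by (auto simp: indicator_def abs_le_iff simp del: abs_divide)
        ultimately show "inverse (ennreal (Q \<xi> powr (a / m))) \<le> f b (x \<bullet> b)"
          using b by (simp add: f_def)
      qed
      also have "\<dots> = (\<Prod>b\<in>Basis. f b (x \<bullet> b))"
      proof -
        have "\<bar>x \<bullet> e1\<bar> \<le> 1"
          using Basis_le_norm[OF e(1), of x] \<xi>(4) by simp
        then have "f e1 (x \<bullet> e1) = 1"
          by (auto simp: f_def indicator_def abs_le_iff)
        then show ?thesis
          using e(1) by (simp add: prod.remove)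
      qed
      finally show ?thesis
        using True by (simp add: \<Psi>_def \<xi>_def)
    qed (auto simp: \<Psi>_def indicator_def)
    have int_f: "(\<integral>\<^sup>+y. f b y \<partial>lborel) = ennreal (l b * H)" if "b \<noteq> e1" for b
    proof -
      have "ennreal (l b * H) = ennreal (l b) * (\<integral>\<^sup>+y. ?h y \<partial>lborel)"
        using l_pos[of b] H by (simp add: ennreal_mult)
      also have "(\<integral>\<^sup>+y. ?h y \<partial>lborel) = ennreal \<bar>1 / l b\<bar> * (\<integral>\<^sup>+y. ?h (0 + (1 / l b) * y) \<partial>lborel)"
        using l_pos[of b] by (intro nn_integral_real_affine) auto
      also have "ennreal (l b) * \<dots> = (\<integral>\<^sup>+y. ?h (0 + (1 / l b) * y) \<partial>lborel)"
        using l_pos[of b] by (simp add: mult.assoc[symmetric] flip: ennreal_mult)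
      finally show ?thesis
        using that by (simp add: f_def)
    qed
    have "(\<integral>\<^sup>+\<xi>. \<Psi> \<xi> \<partial>sphere_measure) =
      (\<integral>\<^sup>+x. \<Psi> (sgn x) * indicator (sphere 0 1) (sgn x) * indicator (ball 0 1) x \<partial>lborel)
        / ennreal V"
      by (simp add: nn_integral_sphere_measure V)
    also have "\<dots> \<le> (\<integral>\<^sup>+x. (\<Prod>b\<in>Basis. f b (x \<bullet> b)) \<partial>lborel) / ennreal V"
      by (intro divide_right_mono_ennreal nn_integral_mono pt)
    also have "(\<integral>\<^sup>+x. (\<Prod>b\<in>Basis. f b (x \<bullet> b)) \<partial>lborel) = (\<Prod>b\<in>Basis. \<integral>\<^sup>+y. f b y \<partial>lborel)"
      by (intro nn_integral_lborel_prod) auto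
    also have "\<dots> = (\<integral>\<^sup>+y. f e1 y \<partial>lborel) * (\<Prod>b\<in>Basis - {e1}. ennreal (l b * H))"
      using e(1) int_f by (simp add: prod.remove)
    also have "(\<integral>\<^sup>+y. f e1 y \<partial>lborel) = ennreal 2"
      by (simp add: f_def)
    also have "(\<Prod>b\<in>Basis - {e1}. ennreal (l b * H)) = ennreal (\<Prod>b\<in>Basis - {e1}. l b * H)"
      using l_pos H by (intro prod_ennreal) (simp add: less_imp_le)
    also have "(\<Prod>b\<in>Basis - {e1}. l b * H) = l1 * l2 ^ (DIM('a) - 2) * H ^ m"
    proof -
      have "(\<Prod>b\<in>Basis - {e1}. l b) = l e2 * (\<Prod>b\<in>Basis - {e1} - {e2}. l b)"
        using e by (intro prod.remove) auto
      also have "(\<Prod>b\<in>Basis - {e1} - {e2}. l b) = (\<Prod>b\<in>Basis - {e1} - {e2}. l2)"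
        by (intro prod.cong) (auto simp: l_def)
      finally show ?thesis
        by (simp add: prod.distrib card1 card2 l_def del: card_Diff_insert)
    qed
    also have "ennreal 2 * ennreal (l1 * l2 ^ (DIM('a) - 2) * H ^ m) / ennreal V
      = ennreal (2 * H ^ m / V * l1 * l2 ^ (DIM('a) - 2))"
      using l H V by (subst ennreal_mult [symmetric]) (auto simp: divide_ennreal mult_ac)
    finally show "(\<integral>\<^sup>+\<xi>. singular_profile l1 l2 a (\<xi> \<bullet> e1) (\<xi> \<bullet> e2) \<partial>sphere_measure) \<le> ennreal (2 * H ^ m / V * l1 * l2 ^ (DIM('a) - 2))"
      unfolding \<Psi>_def Q_def t_def singular_profile_def .
  qed
qed

text \<open>The cone over the cap, cut off by the unit ball, contains a box with sides 1/4,
  \<delta>/8 and, in the remaining \<open>DIM('a) - 2\<close> directions, a multiple of sqrt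
  \<delta>; the volume of the box gives the bound.\<close>

lemma sphere_cap_lower_bound:
  fixes e1 e2 :: "'a::euclidean_space"
  assumes e: "e1 \<in> Basis" "e2 \<in> Basis" "e1 \<noteq> e2"
  obtains c :: real where "0 < c"
    "\<And>\<delta>. 0 < \<delta> \<Longrightarrow> \<delta> \<le> 1 \<Longrightarrow> ennreal (c * \<delta> * sqrt \<delta> ^ (DIM('a) - 2))
       \<le> (\<integral>\<^sup>+\<xi>. indicator {\<xi>. \<bar>1 - \<xi> \<bullet> e1\<bar> + \<bar>\<xi> \<bullet> e2\<bar> < \<delta>} \<xi> \<partial>sphere_measure)"
proof -
  define N where "N = real DIM('a)"
  have N: "1 \<le> N" using DIM_positive[where 'a = 'a] by (simp add: N_def Suc_le_eq)
  obtain V where V: "0 < V" "emeasure lborel (ball (0::'a) 1) = ennreal V"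
    using lborel_ball_pos[where 'a = 'a] emeasure_lborel_ball_finite[of "0::'a" 1]
    by (cases "emeasure lborel (ball (0::'a) 1)") (auto simp: less_le)
  define k where "k = 2 * sqrt (1 / (64 * N))"
  have k: "0 < k" using N by (simp add: k_def)
  show ?thesis
  proof (rule that[of "1 / 32 * k ^ (DIM('a) - 2) / V"])
    show "0 < 1 / 32 * k ^ (DIM('a) - 2) / V" using k V by simp
    fix \<delta> :: real assume \<delta>: "0 < \<delta>" "\<delta> \<le> 1"
    \<comment> \<open>Squares of at most N coordinates of size s add up to at most \<delta>/64, and
      so does the square of the e2 coordinate. The norm then exceeds the e1 coordinate, which is at
      least 1/4, by so little that both terms in the cap condition are at most \<delta>/4.\<close>
    define s where "s = sqrt (\<delta> / (64 * N))"
    have s: "0 < s" "s\<^sup>2 = \<delta> / (64 * N)" "2 * s = k * sqrt \<delta>"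
      using \<delta> N by (auto simp: s_def k_def real_sqrt_divide real_sqrt_mult power_divide power_mult_distrib)
    define lo hi where "lo = (\<lambda>b. if b = e1 then 1 / 4 else if b = e2 then - \<delta> / 16 else - s)"
      and "hi = (\<lambda>b. if b = e1 then 1 / 2 else if b = e2 then \<delta> / 16 else s)"
    define L R where "L = (\<Sum>b\<in>Basis. lo b *\<^sub>R b :: 'a)" and "R = (\<Sum>b\<in>Basis. hi b *\<^sub>R b :: 'a)"
    have LR: "L \<bullet> b = lo b" "R \<bullet> b = hi b" if "b \<in> Basis" for b
      using that by (simp_all add: L_def R_def)
    let ?E = "{\<xi>. \<bar>1 - \<xi> \<bullet> e1\<bar> + \<bar>\<xi> \<bullet> e2\<bar> < \<delta>} :: 'a set"
    have E: "sgn x \<in> ?E \<inter> sphere 0 1" "x \<in> ball 0 1" if "x \<in> cbox L R" for x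
    proof -
      have xb: "lo b \<le> x \<bullet> b" "x \<bullet> b \<le> hi b" if "b \<in> Basis" for b
        using \<open>x \<in> cbox L R\<close> that LR by (auto simp: mem_box)
      define u where "u = x \<bullet> e1"
      have u: "1 / 4 \<le> u" "u \<le> 1 / 2" and v: "\<bar>x \<bullet> e2\<bar> \<le> \<delta> / 16"
        using xb[OF e(1)] xb[OF e(2)] e by (auto simp: lo_def hi_def u_def)
      have "(norm x)\<^sup>2 = u\<^sup>2 + ((x \<bullet> e2)\<^sup>2 + (\<Sum>b\<in>Basis - {e1} - {e2}. (x \<bullet> b)\<^sup>2))"
        unfolding sum_inner_Basis_square u_def sum.remove[OF finite_Basis e(1)]
        using e by (subst sum.remove[of "Basis - {e1}" e2]) auto
      moreover have "(\<Sum>b\<in>Basis - {e1} - {e2}. (x \<bullet> b)\<^sup>2) \<le> (\<Sum>b\<in>Basis - {e1} - {e2}. s\<^sup>2)"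
      proof (rule sum_mono)
        fix b assume b: "b \<in> Basis - {e1} - {e2}"
        then have "\<bar>x \<bullet> b\<bar> \<le> s"
          using xb[of b] by (auto simp: lo_def hi_def)
        then show "(x \<bullet> b)\<^sup>2 \<le> s\<^sup>2"
          using s(1) by (simp add: abs_le_square_iff[symmetric])
      qed
      moreover have "(\<Sum>b\<in>Basis - {e1} - {e2}. s\<^sup>2) \<le> (\<Sum>b\<in>(Basis :: 'a set). s\<^sup>2)"
        by (rule sum_mono2) auto
      moreover have "(\<Sum>b\<in>(Basis :: 'a set). s\<^sup>2) = \<delta> / 64"
        using N by (simp add: s(2) N_def)
      moreover have "(x \<bullet> e2)\<^sup>2 \<le> \<delta> / 64"
      proof -
        have "(x \<bullet> e2)\<^sup>2 \<le> (\<delta> / 16)\<^sup>2"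
          using v \<delta> by (simp add: abs_le_square_iff[symmetric])
        also have "\<dots> \<le> \<delta> / 64"
          using \<delta> mult_left_mono[of \<delta> 1 \<delta>] by (simp add: power2_eq_square)
        finally show ?thesis .
      qed
      ultimately have up: "(norm x)\<^sup>2 \<le> u\<^sup>2 + \<delta> / 32"
        by linarith
      have "u\<^sup>2 \<le> (1/2)\<^sup>2" using u by (intro power_mono) auto
      then have "(norm x)\<^sup>2 < 1" using up \<delta> by (simp add: power2_eq_square)
      then have x1: "norm x < 1" by (simp add: power_less_one_iff abs_square_less_1)
      then show "x \<in> ball 0 1" by simp
      have ux: "u \<le> norm x"
        using Basis_le_norm[OF e(1), of x] by (simp add: u_def)
      then have x0: "0 < norm x" using u by linarith
      have \<delta>x: "\<delta> * (1 / 4) \<le> \<delta> * norm x"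
        using ux u \<delta> by (intro mult_left_mono) auto
      have i1: "sgn x \<bullet> e1 = u / norm x" "sgn x \<bullet> e2 = (x \<bullet> e2) / norm x"
        by (simp_all add: sgn_div_norm u_def divide_inverse_commute)
      have "\<bar>sgn x \<bullet> e2\<bar> \<le> \<delta> / 4"
      proof -
        have "\<bar>x \<bullet> e2\<bar> \<le> \<delta> / 4 * norm x"
          using v \<delta>x by simp
        then show ?thesis using x0 by (simp add: i1 divide_le_eq)
      qed
      moreover have "norm x - u \<le> \<delta> / 4 * norm x"
      proof -
        have "(norm x - u) * (1 / 2) \<le> (norm x - u) * (norm x + u)"
          using ux u by (intro mult_left_mono) auto
        also have "\<dots> \<le> \<delta> / 32"
          using up by (simp add: power2_eq_square algebra_simps)
        also have "\<dots> \<le> \<delta> / 8 * norm x"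
          using \<delta>x by simp
        finally show ?thesis by simp
      qed
      then have "\<bar>1 - sgn x \<bullet> e1\<bar> \<le> \<delta> / 4"
        using x0 ux by (simp add: i1 field_simps abs_if)
      ultimately show "sgn x \<in> ?E \<inter> sphere 0 1"
        using \<delta> x0 by (auto simp: norm_sgn)
    qed
    have lohi: "lo b \<le> hi b" for b
      using \<delta> s by (auto simp: lo_def hi_def)
    have "ennreal (1 / 32 * k ^ (DIM('a) - 2) / V * \<delta> * sqrt \<delta> ^ (DIM('a) - 2))
      = ennreal (\<Prod>b\<in>Basis. (R - L) \<bullet> b) / ennreal V"
    proof -
      have "(\<Prod>b\<in>Basis. (R - L) \<bullet> b) = (\<Prod>b\<in>Basis. hi b - lo b)"
        by (intro prod.cong) (auto simp: inner_diff_left LR)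
      also have "\<dots> = (hi e1 - lo e1) * ((hi e2 - lo e2) * (\<Prod>b\<in>Basis - {e1} - {e2}. hi b - lo b))"
        unfolding prod.remove[OF finite_Basis e(1)]
        using e by (subst prod.remove[of "Basis - {e1}" e2]) auto
      also have "(\<Prod>b\<in>Basis - {e1} - {e2}. hi b - lo b) = (\<Prod>b\<in>Basis - {e1} - {e2}. 2 * s)"
        by (intro prod.cong) (auto simp: hi_def lo_def)
      also have "\<dots> = (k * sqrt \<delta>) ^ (DIM('a) - 2)"
        using e s(3) by (simp add: numeral_2_eq_2)
      finally have eq: "(\<Prod>b\<in>Basis. (R - L) \<bullet> b) = \<delta> / 32 * (k * sqrt \<delta>) ^ (DIM('a) - 2)"
        using e by (simp add: hi_def lo_def)
      show ?thesis
        unfolding eq using \<delta> k V by (simp add: divide_ennreal power_mult_distrib mult_ac)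
    qed
    also have "ennreal (\<Prod>b\<in>Basis. (R - L) \<bullet> b) = emeasure lborel (cbox L R)"
      by (subst emeasure_lborel_cbox) (auto simp: LR lohi)
    also have "\<dots> = (\<integral>\<^sup>+x. indicator (cbox L R) x \<partial>lborel)"
      by simp
    also have "\<dots> \<le> (\<integral>\<^sup>+x. indicator ?E (sgn x) * indicator (sphere 0 1) (sgn x) * indicator (ball 0 1) x \<partial>lborel)"
      using E by (intro nn_integral_mono) (auto simp: indicator_def)
    finally show "ennreal (1 / 32 * k ^ (DIM('a) - 2) / V * \<delta> * sqrt \<delta> ^ (DIM('a) - 2))
       \<le> (\<integral>\<^sup>+\<xi>. indicator ?E \<xi> \<partial>sphere_measure)"
      by (subst nn_integral_sphere_measure) (auto simp: V divide_right_mono_ennreal)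
  qed
qed

section \<open>Nonisotropic geometry\<close>

lemma herm_diff_proj:
  fixes a b c :: "complex ^ 'n"
  assumes "norm b = 1"
  shows "herm (a - herm a b *s b) (c - herm c b *s b) = herm a c - herm a b * cnj (herm c b)"
  using assms by (simp add: herm_simps herm_self cnj_herm algebra_simps)

text \<open>With \<alpha> = \<open>herm a b\<close> the squared norm is at most 1 - |\<alpha>|^2 <=
  2 (1 - |\<alpha>|), and 1 - |\<alpha>| <= |1 - \<alpha>|.\<close>

lemma norm_diff_proj_le:
  fixes a b :: "complex ^ 'n"
  assumes "norm a \<le> 1" "norm b = 1"
  shows "norm (a - herm a b *s b) \<le> sqrt (2 * cmod (1 - herm a b))"
proof -
  have "b \<noteq> 0" using assms by auto
  let ?\<alpha> = "cmod (herm a b)"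
  have "?\<alpha> \<le> 1"
    using herm_Cauchy_Schwarz[of a b] assms by simp
  have "(norm (a - herm a b *s b))\<^sup>2 = (norm a)\<^sup>2 - ?\<alpha>\<^sup>2"
    using norm_diff_proj[OF \<open>b \<noteq> 0\<close>, of a] assms by simp
  also have "\<dots> \<le> 1 - ?\<alpha>\<^sup>2"
    using assms by (simp add: power_le_one)
  also have "\<dots> = (1 - ?\<alpha>) * (1 + ?\<alpha>)"
    by (simp add: power2_eq_square algebra_simps)
  also have "\<dots> \<le> (1 - ?\<alpha>) * 2"
    using \<open>?\<alpha> \<le> 1\<close> by (intro mult_left_mono) auto
  also have "1 - ?\<alpha> \<le> cmod (1 - herm a b)"
    using norm_triangle_ineq2[of 1 "herm a b"] by simp
  finally show ?thesis
    by (intro real_le_rsqrt) simp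
qed

text \<open>Splitting a and c along b bounds |1 - \<open>herm a c\<close>| by A + C + 2 sqrt(A C), a
  perfect square, where A = |1 - \<open>herm a b\<close>| and C = |1 - \<open>herm c b\<close>|. The
  unit length of b makes the splitting orthogonal.\<close>

lemma nonisotropic_dist_triangle:
  fixes a b c :: "complex ^ 'n"
  assumes "norm a \<le> 1" "norm b = 1" "norm c \<le> 1"
  shows "nonisotropic_dist a c \<le> nonisotropic_dist a b + nonisotropic_dist c b"
proof -
  let ?A = "cmod (1 - herm a b)" and ?C = "cmod (1 - herm c b)"
  have "1 - herm a c = (1 - herm a b) + herm a b * cnj (1 - herm c b)
      - herm (a - herm a b *s b) (c - herm c b *s b)"
    by (simp add: herm_diff_proj[OF assms(2)] algebra_simps)
  also have "cmod \<dots> \<le> ?A + cmod (herm a b) * ?C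
      + norm (a - herm a b *s b) * norm (c - herm c b *s b)"
    using herm_Cauchy_Schwarz[of "a - herm a b *s b" "c - herm c b *s b"]
      norm_triangle_ineq[of "1 - herm a b" "herm a b * cnj (1 - herm c b)"]
      norm_triangle_ineq4[of "(1 - herm a b) + herm a b * cnj (1 - herm c b)"
        "herm (a - herm a b *s b) (c - herm c b *s b)"]
    unfolding norm_mult complex_mod_cnj by linarith
  also have "\<dots> \<le> ?A + 1 * ?C + sqrt (2 * ?A) * sqrt (2 * ?C)"
    using herm_Cauchy_Schwarz[of a b] assms norm_diff_proj_le
    by (intro add_mono mult_mono mult_right_mono) auto
  also have "\<dots> = (sqrt ?A + sqrt ?C)\<^sup>2"
    by (simp add: power2_sum real_sqrt_mult)
  finally show ?thesis
    unfolding nonisotropic_dist_def by (intro real_le_lsqrt) auto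
qed

lemma nonisotropic_dist_commute: "nonisotropic_dist a b = nonisotropic_dist b a"
proof -
  have "cmod (1 - herm a b) = cmod (cnj (1 - herm a b))" by (simp only: complex_mod_cnj)
  then show ?thesis by (simp add: nonisotropic_dist_def cnj_herm)
qed

lemma one_minus_herm_commute: "cmod (1 - herm a b) = cmod (1 - herm b a)"
  using nonisotropic_dist_commute[of a b] by (simp add: nonisotropic_dist_def)

lemma carleson_region_iff:
  "z \<in> carleson_region \<xi> \<delta> \<longleftrightarrow> norm z < 1 \<and> cmod (1 - herm z \<xi>) < \<delta>"
  by (simp add: carleson_region_def nonisotropic_dist_def)

section \<open>Replacing points of the ball by their radial projections\<close>

lemma norm_sgn_scaleR: "norm w *\<^sub>R sgn w = (w :: 'a::real_normed_vector)"
  by (cases "w = 0") (simp_all add: sgn_div_norm)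

lemma herm_sgn_right: "herm z w = complex_of_real (norm w) * herm z (sgn w)"
  by (metis herm_simps(9) norm_sgn_scaleR)

lemma one_minus_herm_sgn_diff:
  fixes z w :: "complex ^ 'n"
  assumes "norm z \<le> 1" "norm w \<le> 1"
  shows "cmod (herm z (sgn w) - herm z w) \<le> 1 - norm w"
proof -
  have "herm z (sgn w) - herm z w = complex_of_real (1 - norm w) * herm z (sgn w)"
    by (subst herm_sgn_right[of z w]) (simp add: algebra_simps)
  then have "cmod (herm z (sgn w) - herm z w) = (1 - norm w) * cmod (herm z (sgn w))"
    using assms by (simp add: norm_mult del: of_real_diff)
  also have "cmod (herm z (sgn w)) \<le> 1 * 1"
    by (rule order_trans[OF herm_Cauchy_Schwarz], rule mult_mono) (use assms in \<open>auto simp: norm_sgn\<close>)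
  then have "(1 - norm w) * cmod (herm z (sgn w)) \<le> (1 - norm w) * 1"
    using assms by (intro mult_left_mono) auto
  finally show ?thesis by simp
qed

text \<open>Moving w to the sphere changes the pairing by at most 1 - |w|, which is itself at most
  |1 - \<open>herm z w\<close>|; hence the factor 2.\<close>

lemma one_minus_herm_sgn_le:
  fixes z w :: "complex ^ 'n"
  assumes "norm z \<le> 1" "norm w \<le> 1"
  shows "cmod (1 - herm z (sgn w)) \<le> 2 * cmod (1 - herm z w)"
    and "cmod (1 - herm z w) \<le> cmod (1 - herm z (sgn w)) + (1 - norm w)"
proof -
  note d = one_minus_herm_sgn_diff[OF assms]
  have "cmod (1 - herm z (sgn w)) \<le> cmod (1 - herm z w) + cmod (herm z (sgn w) - herm z w)"
    using norm_triangle_ineq4[of "1 - herm z w" "herm z (sgn w) - herm z w"] by simp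
  then show "cmod (1 - herm z (sgn w)) \<le> 2 * cmod (1 - herm z w)"
    using d one_minus_herm_ge(2)[OF assms] by linarith
  have "cmod (1 - herm z w) \<le> cmod (1 - herm z (sgn w)) + cmod (herm z (sgn w) - herm z w)"
    using norm_triangle_ineq[of "1 - herm z (sgn w)" "herm z (sgn w) - herm z w"] by simp
  then show "cmod (1 - herm z w) \<le> cmod (1 - herm z (sgn w)) + (1 - norm w)"
    using d by linarith
qed

text \<open>The same argument in the first variable, the change now being at most 1 - r.\<close>

lemma one_minus_herm_radius:
  fixes \<xi> w :: "complex ^ 'n"
  assumes "norm \<xi> = 1" "norm w \<le> 1" "0 \<le> r" "r \<le> 1"
  shows "cmod (1 - herm (r *\<^sub>R \<xi>) w) \<le> (1 - r) + cmod (1 - herm \<xi> w)"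
    and "cmod (1 - herm \<xi> w) \<le> 2 * cmod (1 - herm (r *\<^sub>R \<xi>) w)"
proof -
  have h: "cmod (herm \<xi> w) \<le> 1"
    using herm_Cauchy_Schwarz[of \<xi> w] assms by simp
  have "herm \<xi> w - herm (r *\<^sub>R \<xi>) w = complex_of_real (1 - r) * herm \<xi> w"
    by (simp add: herm_simps algebra_simps)
  then have "cmod (herm \<xi> w - herm (r *\<^sub>R \<xi>) w) = (1 - r) * cmod (herm \<xi> w)"
    using assms by (simp add: norm_mult del: of_real_diff)
  also have "\<dots> \<le> (1 - r) * 1"
    using assms h by (intro mult_left_mono) auto
  finally have d: "cmod (herm \<xi> w - herm (r *\<^sub>R \<xi>) w) \<le> 1 - r" by simp
  have "cmod (1 - herm (r *\<^sub>R \<xi>) w) \<le> cmod (1 - herm \<xi> w) + cmod (herm \<xi> w - herm (r *\<^sub>R \<xi>) w)"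
    using norm_triangle_ineq[of "1 - herm \<xi> w" "herm \<xi> w - herm (r *\<^sub>R \<xi>) w"] by simp
  then show "cmod (1 - herm (r *\<^sub>R \<xi>) w) \<le> (1 - r) + cmod (1 - herm \<xi> w)"
    using d by linarith
  have "cmod (1 - herm \<xi> w) \<le> cmod (1 - herm (r *\<^sub>R \<xi>) w) + cmod (herm \<xi> w - herm (r *\<^sub>R \<xi>) w)"
    using norm_triangle_ineq4[of "1 - herm (r *\<^sub>R \<xi>) w" "herm \<xi> w - herm (r *\<^sub>R \<xi>) w"] by simp
  moreover have "1 - norm (r *\<^sub>R \<xi>) \<le> cmod (1 - herm (r *\<^sub>R \<xi>) w)"
    using assms by (intro one_minus_herm_ge(1)) auto
  ultimately show "cmod (1 - herm \<xi> w) \<le> 2 * cmod (1 - herm (r *\<^sub>R \<xi>) w)"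
    using d assms by simp
qed

text \<open>Applied with x + i y = \<open>herm \<xi> (sgn w)\<close>, s = |w|, D = |1 -
  \<open>herm (r *\<^sub>R \<xi>) w\<close>| and P =
  |\<open>ball_aut w (r *\<^sub>R \<xi>)\<close>|^2. The condition P < 1/4 forces D^2 <= 6 (1 - r)
  (1 - s), while D is at least 1 - r and 1 - s; so all three are comparable within the factor
  6.\<close>

lemma near_pole_real:
  fixes r s x y D P :: real
  assumes r: "1 / 2 \<le> r" "r < 1" and s: "0 \<le> s" "s < 1"
    and D: "1 - r \<le> D" "1 - s \<le> D" "D\<^sup>2 = (1 - r * s * x)\<^sup>2 + (r * s * y)\<^sup>2"
    and P: "P * D\<^sup>2 = D\<^sup>2 - (1 - r\<^sup>2) * (1 - s\<^sup>2)" "0 \<le> P" "P < 1 / 4"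
    and xy: "x\<^sup>2 + y\<^sup>2 \<le> 1"
  shows "D \<le> 6 * (1 - r)" "1 - r \<le> 6 * (1 - s)"
    "(y / (6 * (1 - r)))\<^sup>2 + (1 - x\<^sup>2 - y\<^sup>2) / (216 * (1 - r)) \<le> 4 * P"
proof -
  define \<alpha> \<beta> where "\<alpha> = 1 - r" and "\<beta> = 1 - s"
  have ab: "0 < \<alpha>" "0 < \<beta>" "\<alpha> \<le> D" "\<beta> \<le> D" using r s D by (auto simp: \<alpha>_def \<beta>_def)
  then have D0: "0 < D" by linarith
  have "P * D\<^sup>2 \<le> 1 / 4 * D\<^sup>2" using P by (intro mult_right_mono) auto
  then have "3 / 4 * D\<^sup>2 \<le> (1 - r\<^sup>2) * (1 - s\<^sup>2)" using P(1) by linarith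
  also have "\<dots> = (\<alpha> * \<beta>) * ((1 + r) * (1 + s))" by (simp add: \<alpha>_def \<beta>_def power2_eq_square algebra_simps)
  also have "\<dots> \<le> (\<alpha> * \<beta>) * (2 * 2)" using r s ab by (intro mult_left_mono mult_mono) auto
  finally have D2: "D\<^sup>2 \<le> 6 * \<alpha> * \<beta>"
    using mult_pos_pos[OF ab(1,2)] by simp
  have "6 * \<alpha> * \<beta> \<le> 6 * \<alpha> * D"
    using ab by (intro mult_left_mono) auto
  then have "D * D \<le> 6 * \<alpha> * D"
    using D2 unfolding power2_eq_square by linarith
  then show D6: "D \<le> 6 * (1 - r)" using D0 by (simp add: \<alpha>_def)
  have "D * \<alpha> \<le> D\<^sup>2" using ab D0 by (simp add: power2_eq_square)
  then have "D * \<alpha> \<le> 6 * \<beta> * \<alpha>" using D2 by (simp add: mult_ac)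
  then have "D \<le> 6 * \<beta>" using ab by simp
  then show sr: "1 - r \<le> 6 * (1 - s)" using ab by (simp add: \<alpha>_def \<beta>_def)
  define t where "t = 1 - x\<^sup>2 - y\<^sup>2"
  have t: "0 \<le> t" using xy by (simp add: t_def)
  \<comment> \<open>An exact decomposition: the first square measures the radial offset and will be
    dropped; the other two terms control y and the complex orthogonal part t.\<close>
  have id: "P * D\<^sup>2 = (s - r * x)\<^sup>2 + (r * y)\<^sup>2 + (1 - s\<^sup>2) * (r\<^sup>2 * t)"
    unfolding P(1) unfolding D(3) t_def by (simp add: power2_eq_square algebra_simps)
  have r2: "1 / 4 \<le> r\<^sup>2" using power_mono[OF r(1), of 2] by (simp add: power2_eq_square)
  have "1 / 4 * y\<^sup>2 \<le> (r * y)\<^sup>2"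
    unfolding power_mult_distrib using r2 by (intro mult_right_mono) auto
  moreover have "(\<alpha> / 6) * (1 / 4 * t) \<le> (1 - s\<^sup>2) * (r\<^sup>2 * t)"
  proof (intro mult_mono mult_right_mono)
    have "\<alpha> / 6 \<le> 1 - s" using sr by (simp add: \<alpha>_def)
    also have "\<dots> \<le> 1 - s\<^sup>2" using s by (simp add: power2_eq_square mult_left_le)
    finally show "\<alpha> / 6 \<le> 1 - s\<^sup>2" .
    show "0 \<le> 1 - s\<^sup>2" using s by (simp add: power_le_one)
  qed (use r2 t in auto)
  ultimately have "y\<^sup>2 / 4 + \<alpha> * t / 24 \<le> P * D\<^sup>2"
    unfolding id using zero_le_power2[of "s - r * x"] by linarith
  also have "\<dots> \<le> P * (6 * \<alpha>)\<^sup>2"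
    using D6 D0 P by (intro mult_left_mono power_mono) (auto simp: \<alpha>_def)
  \<comment> \<open>Division by 9 (1 - r)^2 normalises y by 6 (1 - r), turns 24 into 216, and
    reduces the factor 36 on the right to 4.\<close>
  finally have "(y\<^sup>2 / 4 + \<alpha> * t / 24) / (9 * \<alpha>\<^sup>2) \<le> P * (6 * \<alpha>)\<^sup>2 / (9 * \<alpha>\<^sup>2)"
    using ab by (intro divide_right_mono) auto
  also have "P * (6 * \<alpha>)\<^sup>2 / (9 * \<alpha>\<^sup>2) = 4 * P"
    using ab by (simp add: field_simps power2_eq_square)
  also have "(y\<^sup>2 / 4 + \<alpha> * t / 24) / (9 * \<alpha>\<^sup>2) = (y / (6 * \<alpha>))\<^sup>2 + t / (216 * \<alpha>)"
    using ab by (simp add: field_simps power2_eq_square)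
  finally show "(y / (6 * (1 - r)))\<^sup>2 + (1 - x\<^sup>2 - y\<^sup>2) / (216 * (1 - r)) \<le> 4 * P"
    unfolding \<alpha>_def t_def .
qed

text \<open>An explicit majorant, up to a factor, of the pole of \<open>green (r *\<^sub>R \<xi>) w\<close>, with \<open>\<delta> = 1 - r\<close>.
  Its support conditions follow from \<open>norm (ball_aut w (r *\<^sub>R \<xi>)) < 1 / 2\<close>, and it depends on \<open>\<xi>\<close>
  only through \<open>herm \<xi> w\<close>.\<close>

definition near_kernel :: "real \<Rightarrow> complex ^ 'n \<Rightarrow> complex ^ 'n \<Rightarrow> ennreal" where
  "near_kernel \<delta> \<xi> w = (if w \<noteq> 0 \<and> cmod (1 - herm w \<xi>) < 13 * \<delta> \<and> \<delta> \<le> 6 * (1 - norm w) \<and> 1 - norm w \<le> 6 * \<delta>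
     then singular_profile (6 * \<delta>) (sqrt (216 * \<delta>)) (real (CARD('n) - 1))
       (Re (herm \<xi> (sgn w))) (Im (herm \<xi> (sgn w))) else 0)"

text \<open>The bound Q <= 4 P of \<open>near_pole_real\<close>, raised to the power n - 1, accounts
  for the factor 4^(n - 1). Since 4 P < 1, both summands of Q are at most 1, which gives the cutoffs
  in \<open>singular_profile\<close>. For w = 0 the automorphism has norm r >= 1/2, so that point is
  excluded.\<close>

lemma near_kernel_lower:
  fixes \<xi> w :: "complex ^ 'n"
  assumes n: "CARD('n) > 1" and r: "1 / 2 \<le> r" "r < 1" and \<xi>: "norm \<xi> = 1" and w: "norm w < 1"
    and near: "norm (ball_aut w (r *\<^sub>R \<xi>)) < 1 / 2"
  shows "inverse (ennreal (norm (ball_aut w (r *\<^sub>R \<xi>)) ^ (2 * CARD('n) - 2)))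
      \<le> ennreal (4 ^ (CARD('n) - 1)) * near_kernel (1 - r) \<xi> w"
    and "1 - r \<le> 6 * (1 - norm w)"
proof -
  let ?\<zeta> = "herm \<xi> (sgn w)" and ?s = "norm w"
  define x y where "x = Re ?\<zeta>" and "y = Im ?\<zeta>"
  define P where "P = (norm (ball_aut w (r *\<^sub>R \<xi>)))\<^sup>2"
  define D where "D = cmod (1 - herm (r *\<^sub>R \<xi>) w)"
  have z: "norm (r *\<^sub>R \<xi>) = r" using r \<xi> by simp
  have P_eq: "P = 1 - (1 - r\<^sup>2) * (1 - ?s\<^sup>2) / D\<^sup>2"
    unfolding P_def D_def using norm_ball_aut[of "r *\<^sub>R \<xi>" w] r w z by simp
  have D: "1 - r \<le> D" "1 - ?s \<le> D"
    unfolding D_def using one_minus_herm_ge[of "r *\<^sub>R \<xi>" w] r w z by auto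
  have D0: "0 < D" using D r by linarith
  have P1: "P * D\<^sup>2 = D\<^sup>2 - (1 - r\<^sup>2) * (1 - ?s\<^sup>2)"
    using D0 by (simp add: P_eq field_simps)
  have P2: "0 \<le> P" "P < 1 / 4"
    using power_strict_mono[OF near, of 2] by (auto simp: P_def power2_eq_square)
  have w0: "w \<noteq> 0"
  proof
    assume "w = 0"
    then have "P = r\<^sup>2" by (simp add: P_eq D_def herm_simps)
    then show False using power_mono[OF r(1), of 2] P2 by (simp add: power2_eq_square)
  qed
  have "herm (r *\<^sub>R \<xi>) w = complex_of_real (r * ?s) * ?\<zeta>"
    by (subst herm_sgn_right) (simp add: herm_simps)
  then have D2: "D\<^sup>2 = (1 - r * ?s * x)\<^sup>2 + (r * ?s * y)\<^sup>2"
    unfolding D_def cmod_power2 by (simp add: x_def y_def)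
  have xy: "x\<^sup>2 + y\<^sup>2 \<le> 1"
  proof -
    have "cmod ?\<zeta> \<le> 1"
      using herm_Cauchy_Schwarz[of \<xi> "sgn w"] w0 \<xi> by (simp add: norm_sgn)
    then show ?thesis
      using power_le_one[of "cmod ?\<zeta>" 2] unfolding cmod_power2 by (simp add: x_def y_def)
  qed
  note est = near_pole_real[OF r norm_ge_zero w D D2 P1 P2 xy]
  show "1 - r \<le> 6 * (1 - ?s)" by (rule est(2))
  define \<delta> where "\<delta> = 1 - r"
  have \<delta>: "0 < \<delta>" using r by (simp add: \<delta>_def)
  have "cmod (1 - herm \<xi> w) \<le> 2 * D"
    unfolding D_def using r w \<xi> by (intro one_minus_herm_radius) auto
  \<comment> \<open>From D <= 6 \<delta> this is at most 12 \<delta>; the constant 13 makes the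
    inequality strict.\<close>
  then have c1: "cmod (1 - herm w \<xi>) < 13 * \<delta>"
    using est(1) \<delta> by (subst one_minus_herm_commute) (simp add: \<delta>_def)
  define Q where "Q = (y / (6 * \<delta>))\<^sup>2 + (1 - x\<^sup>2 - y\<^sup>2) / (216 * \<delta>)"
  have Q: "0 \<le> Q" "Q \<le> 4 * P"
    using est(3) xy \<delta> by (auto simp: Q_def \<delta>_def intro!: add_nonneg_nonneg divide_nonneg_nonneg)
  have "Q \<le> 1" using Q P2 by linarith
  have "0 \<le> (1 - x\<^sup>2 - y\<^sup>2) / (216 * \<delta>)" using xy \<delta> by simp
  then have "(y / (6 * \<delta>))\<^sup>2 \<le> 1\<^sup>2"
    using \<open>Q \<le> 1\<close> unfolding Q_def power_one by linarith
  then have c2: "\<bar>y\<bar> \<le> 6 * \<delta>"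
    using \<delta> unfolding abs_le_square_iff[symmetric] by simp
  have "(1 - x\<^sup>2 - y\<^sup>2) / (216 * \<delta>) \<le> 1"
    using \<open>Q \<le> 1\<close> zero_le_power2[of "y / (6 * \<delta>)"] unfolding Q_def by linarith
  then have c3: "1 - x\<^sup>2 - y\<^sup>2 \<le> 216 * \<delta>" using \<delta> by simp
  have c4: "1 - ?s \<le> 6 * \<delta>" using est(1) D unfolding \<delta>_def by linarith
  have nk: "near_kernel \<delta> \<xi> w = inverse (ennreal (Q ^ (CARD('n) - 1)))"
  proof -
    have "(sqrt (216 * \<delta>))\<^sup>2 = 216 * \<delta>" using \<delta> by simp
    moreover have "Q powr real (CARD('n) - 1) = Q ^ (CARD('n) - 1)"
      using n Q(1) by (intro powr_realpow') auto
    moreover have "\<delta> \<le> 6 * (1 - ?s)" using est(2) by (simp add: \<delta>_def)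
    ultimately show ?thesis
      unfolding near_kernel_def singular_profile_def x_def[symmetric] y_def[symmetric]
      using w0 c1 c2 c3 c4 by (simp only: Q_def[symmetric]) simp
  qed
  have "inverse (ennreal (norm (ball_aut w (r *\<^sub>R \<xi>)) ^ (2 * CARD('n) - 2))) = inverse (ennreal (P ^ (CARD('n) - 1)))"
    by (simp add: P_def power_mult[symmetric] right_diff_distrib')
  also have "\<dots> \<le> inverse (ennreal ((1 / 4) ^ (CARD('n) - 1) * Q ^ (CARD('n) - 1)))"
  proof (intro ennreal_inverse_antimono ennreal_leI)
    have "(Q / 4) ^ (CARD('n) - 1) \<le> P ^ (CARD('n) - 1)"
      using Q by (intro power_mono) auto
    then show "(1 / 4) ^ (CARD('n) - 1) * Q ^ (CARD('n) - 1) \<le> P ^ (CARD('n) - 1)"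
      by (simp add: power_divide)
  qed
  also have "\<dots> = ennreal (4 ^ (CARD('n) - 1)) * inverse (ennreal (Q ^ (CARD('n) - 1)))"
  proof -
    have "inverse (ennreal ((1 / 4) ^ (CARD('n) - 1))) = ennreal (4 ^ (CARD('n) - 1))"
      by (subst inverse_ennreal) (simp_all add: power_one_over)
    then show ?thesis
      using Q(1) by (subst ennreal_mult, simp, simp, subst ennreal_inverse_mult) simp_all
  qed
  finally show "inverse (ennreal (norm (ball_aut w (r *\<^sub>R \<xi>)) ^ (2 * CARD('n) - 2)))
      \<le> ennreal (4 ^ (CARD('n) - 1)) * near_kernel (1 - r) \<xi> w"
    unfolding nk[symmetric] \<delta>_def .
qed

section \<open>Measurability and spherical integrals of the kernels\<close>

lemma borel_measurable_herm [measurable (raw)]: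
  assumes [measurable]: "f \<in> borel_measurable M" "g \<in> borel_measurable M"
  shows "(\<lambda>x. herm (f x) (g x :: complex ^ 'n)) \<in> borel_measurable M"
proof -
  have [measurable]: "(\<lambda>x. h x $ j) \<in> borel_measurable M" if "h \<in> borel_measurable M"
    for h :: "'a \<Rightarrow> complex ^ 'n" and j
    using that by (rule borel_measurable_continuous_on[rotated]) (intro continuous_intros)
  have "(\<lambda>x. cnj (g x $ j)) \<in> borel_measurable M" for j
    by (rule borel_measurable_continuous_on[OF continuous_on_cnj[OF continuous_on_id]]) measurable
  then show ?thesis
    unfolding herm_def by measurable
qed

lemma borel_measurable_singular_profile [measurable (raw)]:
  assumes [measurable]: "f \<in> borel_measurable M" "g \<in> borel_measurable M"
  shows "(\<lambda>x. singular_profile l1 l2 a (f x) (g x)) \<in> borel_measurable M"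
  unfolding singular_profile_def by measurable

lemma borel_measurable_near_kernel [measurable (raw)]:
  assumes [measurable]: "f \<in> borel_measurable M" "g \<in> borel_measurable M"
  shows "(\<lambda>x. near_kernel \<delta> (f x) (g x)) \<in> borel_measurable M"
proof -
  note [measurable] = measurable_compose[OF _ borel_measurable_sgn_vec]
  show ?thesis
    unfolding near_kernel_def by measurable
qed

lemma indicator_carleson_region:
  "indicator (carleson_region \<xi> s) w = (if norm w < 1 \<and> cmod (1 - herm w \<xi>) < s then 1 else 0)"
  by (simp add: indicator_def carleson_region_iff)

lemma borel_measurable_indicator_carleson_region [measurable (raw)]:
  assumes [measurable]: "f \<in> borel_measurable M" "g \<in> borel_measurable M"
  shows "(\<lambda>x. indicator (carleson_region (f x) s) (g x) :: ennreal) \<in> borel_measurable M"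
  unfolding indicator_carleson_region by measurable

lemma measurable_sphere_measure_borel [measurable]: "(\<lambda>x. x) \<in> measurable sphere_measure borel"
  unfolding measurable_cong_sets[OF sets_sphere_measure refl] by (intro measurable_restrict_space1) simp

lemma epowr_singular_profile:
  assumes "0 < p"
  shows "epowr (singular_profile l1 l2 a x y) p = singular_profile l1 l2 (a * p) x y"
proof -
  have "epowr (inverse (ennreal (q powr a))) p = inverse (ennreal (q powr (a * p)))" for q :: real
  proof (cases "q = 0")
    case False
    then show ?thesis
      by (simp add: inverse_ennreal epowr_ennreal powr_powr powr_minus[symmetric])
  qed simp
  then show ?thesis
    by (simp add: singular_profile_def)
qed

text \<open>The real and imaginary parts of \<open>herm \<xi> \<eta>\<close> are the real inner
  products with \<eta> and i \<eta>, an orthonormal pair that can be moved to two coordinate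
  vectors.\<close>

lemma nn_integral_sphere_herm:
  fixes \<eta> :: "complex ^ 'n" and k :: 'n and F :: "real \<Rightarrow> real \<Rightarrow> ennreal"
  assumes \<eta>: "norm \<eta> = 1" and [measurable]: "case_prod F \<in> borel_measurable (borel \<Otimes>\<^sub>M borel)"
  shows "(\<integral>\<^sup>+\<xi>. F (Re (herm \<xi> \<eta>)) (Im (herm \<xi> \<eta>)) \<partial>sphere_measure)
    = (\<integral>\<^sup>+\<xi>. F (\<xi> \<bullet> axis k 1) (\<xi> \<bullet> axis k \<i>) \<partial>sphere_measure)"
proof -
  have im: "Im (herm \<xi> \<eta>) = \<xi> \<bullet> (\<i> *s \<eta>)" for \<xi>
    by (simp add: Re_herm[symmetric] herm_simps)
  have "\<eta> \<bullet> (\<i> *s \<eta>) = 0"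
    by (simp add: im[symmetric] herm_self)
  then show ?thesis
    unfolding im Re_herm using \<eta>
    by (intro nn_integral_sphere_inner2) (auto simp: norm_smult norm_eq_sqrt_inner[of "axis _ _"] inner_axis_axis)
qed

lemma axis_Basis_complex:
  "axis k 1 \<in> (Basis :: (complex ^ 'n) set)" "axis k \<i> \<in> (Basis :: (complex ^ 'n) set)"
  "axis k (1::complex) \<noteq> axis k \<i>"
  by (auto simp: Basis_vec_def axis_eq_axis Basis_complex_def)

text \<open>The p-th power stays in the family of profiles, with exponent a = (n - 1) p. In real
  dimension 2 n the integrability condition 2 a < 2 n - 1 is the upper bound on p. The scale 6
  \<delta> once and sqrt(216 \<delta>) in 2 n - 2 directions give \<delta>^n.\<close>

lemma near_kernel_sphere_integral:
  assumes n: "CARD('n) > 1" and p: "1 < p" "p < (2 * real CARD('n) - 1) / (2 * (real CARD('n) - 1))"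
  obtains A :: real where "0 \<le> A"
    "\<And>\<delta> (w :: complex ^ 'n). 0 < \<delta> \<Longrightarrow>
      (\<integral>\<^sup>+\<xi>. epowr (near_kernel \<delta> \<xi> w) p \<partial>sphere_measure) \<le> ennreal (A * \<delta> ^ CARD('n))"
proof -
  obtain k :: 'n where True by simp
  define a where "a = real (CARD('n) - 1) * p"
  have N: "real (CARD('n) - 1) = real CARD('n) - 1" "0 < real CARD('n) - 1"
    using n by (simp_all add: of_nat_diff)
  have "p * (2 * (real CARD('n) - 1)) < 2 * real CARD('n) - 1"
    using p(2) N(2) by (simp add: pos_less_divide_eq)
  moreover have "2 * a = p * (2 * (real CARD('n) - 1))" "real DIM(complex ^ 'n) = 2 * real CARD('n)"
    unfolding a_def N by simp_all
  moreover have "0 < a"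
    unfolding a_def N using p(1) N(2) by (intro mult_pos_pos) auto
  ultimately have a: "0 < a" "2 * a < DIM(complex ^ 'n) - 1"
    by linarith+
  obtain A where A: "0 \<le> A" "\<And>l1 l2. 0 < l1 \<Longrightarrow> 0 < l2 \<Longrightarrow>
      (\<integral>\<^sup>+\<xi>. singular_profile l1 l2 a (\<xi> \<bullet> axis k 1) (\<xi> \<bullet> (axis k \<i> :: complex ^ 'n)) \<partial>sphere_measure)
        \<le> ennreal (A * l1 * l2 ^ (DIM(complex ^ 'n) - 2))"
    using sphere_singular_integral[OF axis_Basis_complex(1)[of k] axis_Basis_complex(2)[of k] axis_Basis_complex(3) a] by blast
  show ?thesis
  proof (rule that[of "A * 6 * 216 ^ (CARD('n) - 1)"])
    show "0 \<le> A * 6 * 216 ^ (CARD('n) - 1)" using A by simp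
    fix \<delta> :: real and w :: "complex ^ 'n" assume \<delta>: "0 < \<delta>"
    show "(\<integral>\<^sup>+\<xi>. epowr (near_kernel \<delta> \<xi> w) p \<partial>sphere_measure)
      \<le> ennreal (A * 6 * 216 ^ (CARD('n) - 1) * \<delta> ^ CARD('n))"
    proof (cases "w = 0")
      case True
      then show ?thesis by (simp add: near_kernel_def)
    next
      case False
      have "(\<integral>\<^sup>+\<xi>. epowr (near_kernel \<delta> \<xi> w) p \<partial>sphere_measure)
        \<le> (\<integral>\<^sup>+\<xi>. singular_profile (6 * \<delta>) (sqrt (216 * \<delta>)) a (Re (herm \<xi> (sgn w))) (Im (herm \<xi> (sgn w))) \<partial>sphere_measure)"
        using p by (intro nn_integral_mono) (auto simp: near_kernel_def epowr_singular_profile a_def)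
      also have "\<dots> = (\<integral>\<^sup>+\<xi>. singular_profile (6 * \<delta>) (sqrt (216 * \<delta>)) a (\<xi> \<bullet> axis k 1) (\<xi> \<bullet> (axis k \<i> :: complex ^ 'n)) \<partial>sphere_measure)"
        using False by (intro nn_integral_sphere_herm) (auto simp: norm_sgn)
      also have "\<dots> \<le> ennreal (A * (6 * \<delta>) * sqrt (216 * \<delta>) ^ (DIM(complex ^ 'n) - 2))"
        using \<delta> by (intro A) auto
      also have "sqrt (216 * \<delta>) ^ (DIM(complex ^ 'n) - 2) = (216 * \<delta>) ^ (CARD('n) - 1)"
      proof -
        have "DIM(complex ^ 'n) - 2 = 2 * (CARD('n) - 1)" by simp
        then show ?thesis using \<delta> by (simp only: power_mult) simp
      qed
      also have "A * (6 * \<delta>) * (216 * \<delta>) ^ (CARD('n) - 1) = A * 6 * 216 ^ (CARD('n) - 1) * \<delta> ^ CARD('n)"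
        using n by (simp add: power_mult_distrib power_eq_if[of \<delta> "CARD('n)"])
      finally show ?thesis .
    qed
  qed
qed

text \<open>For \<xi> in the cap of size \<delta> about w / |w| one has |1 -
  \<open>herm w \<xi>\<close>| < \<delta> + 6 \<delta> = 7 \<delta>. The larger radius 14 \<delta>
  is chosen to exceed 13 \<delta>, the support radius of \<open>near_kernel\<close>, as the
  comparison by \<open>carleson_region_subset\<close> requires.\<close>

lemma carleson_region_sphere_integral:
  assumes n: "CARD('n) > 1"
  obtains c :: real where "0 < c"
    "\<And>\<delta> (w :: complex ^ 'n). 0 < \<delta> \<Longrightarrow> \<delta> \<le> 1 \<Longrightarrow> w \<noteq> 0 \<Longrightarrow> norm w < 1 \<Longrightarrow> 1 - norm w \<le> 6 * \<delta> \<Longrightarrow>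
      ennreal (c * \<delta> ^ CARD('n)) \<le> (\<integral>\<^sup>+\<xi>. indicator (carleson_region \<xi> (14 * \<delta>)) w \<partial>sphere_measure)"
proof -
  obtain k :: 'n where True by simp
  obtain c where c: "0 < c" "\<And>\<delta>. 0 < \<delta> \<Longrightarrow> \<delta> \<le> 1 \<Longrightarrow> ennreal (c * \<delta> * sqrt \<delta> ^ (DIM(complex ^ 'n) - 2))
       \<le> (\<integral>\<^sup>+\<xi>. indicator {\<xi>. \<bar>1 - \<xi> \<bullet> axis k 1\<bar> + \<bar>\<xi> \<bullet> (axis k \<i> :: complex ^ 'n)\<bar> < \<delta>} \<xi> \<partial>sphere_measure)"
    using sphere_cap_lower_bound[OF axis_Basis_complex(1)[of k] axis_Basis_complex(2)[of k] axis_Basis_complex(3)] by blast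
  show ?thesis
  proof (rule that[OF c(1)])
    fix \<delta> and w :: "complex ^ 'n"
    assume \<delta>: "0 < \<delta>" "\<delta> \<le> 1" and w: "w \<noteq> 0" "norm w < 1" "1 - norm w \<le> 6 * \<delta>"
    let ?F = "\<lambda>x y. if \<bar>1 - x\<bar> + \<bar>y\<bar> < \<delta> then 1 else 0 :: ennreal"
    have "sqrt \<delta> ^ (DIM(complex ^ 'n) - 2) = \<delta> ^ (CARD('n) - 1)"
    proof -
      have "DIM(complex ^ 'n) - 2 = 2 * (CARD('n) - 1)" by simp
      then show ?thesis using \<delta> by (simp only: power_mult) simp
    qed
    then have "ennreal (c * \<delta> ^ CARD('n)) = ennreal (c * \<delta> * sqrt \<delta> ^ (DIM(complex ^ 'n) - 2))"
      using n by (simp add: power_eq_if[of \<delta> "CARD('n)"] mult.assoc)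
    also have "\<dots> \<le> (\<integral>\<^sup>+\<xi>. ?F (\<xi> \<bullet> axis k 1) (\<xi> \<bullet> (axis k \<i> :: complex ^ 'n)) \<partial>sphere_measure)"
      using c(2)[OF \<delta>] by (simp add: indicator_def of_bool_def)
    also have "\<dots> = (\<integral>\<^sup>+\<xi>. ?F (Re (herm \<xi> (sgn w))) (Im (herm \<xi> (sgn w))) \<partial>sphere_measure)"
    proof (rule nn_integral_sphere_herm[symmetric])
      show "norm (sgn w) = 1" using w by (simp add: norm_sgn)
      show "case_prod ?F \<in> borel_measurable (borel \<Otimes>\<^sub>M borel)"
        by measurable
    qed
    also have "\<dots> \<le> (\<integral>\<^sup>+\<xi>. indicator (carleson_region \<xi> (14 * \<delta>)) w \<partial>sphere_measure)"
    proof (rule nn_integral_mono)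
      fix \<xi> assume "\<xi> \<in> space (sphere_measure :: (complex ^ 'n) measure)"
      then have \<xi>: "norm \<xi> = 1" by (simp add: space_sphere_measure)
      have "cmod (1 - herm w \<xi>) < 14 * \<delta>"
        if "\<bar>1 - Re (herm \<xi> (sgn w))\<bar> + \<bar>Im (herm \<xi> (sgn w))\<bar> < \<delta>"
        using cmod_le[of "1 - herm \<xi> (sgn w)"] that w \<delta> \<xi> one_minus_herm_sgn_le(2)[of \<xi> w]
        by (subst one_minus_herm_commute) simp
      then show "?F (Re (herm \<xi> (sgn w))) (Im (herm \<xi> (sgn w))) \<le> indicator (carleson_region \<xi> (14 * \<delta>)) w"
        using w by (auto simp: indicator_def carleson_region_iff)
    qed
    finally show "ennreal (c * \<delta> ^ CARD('n)) \<le> (\<integral>\<^sup>+\<xi>. indicator (carleson_region \<xi> (14 * \<delta>)) w \<partial>sphere_measure)" .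
  qed
qed

text \<open>The engulfing property, by three legs from v to \<xi>, to \<open>sgn w\<close>, to
  \<xi>', each shorter than sqrt(2 t); and 3 sqrt(2 t) = sqrt(18 t). The triangle inequality asks
  for middle points on the sphere, so w is replaced by \<open>sgn w\<close> at the cost of the
  factor 2.\<close>

lemma carleson_region_subset:
  fixes \<xi> \<xi>' w :: "complex ^ 'n"
  assumes \<xi>: "norm \<xi> = 1" "norm \<xi>' = 1" and w: "w \<noteq> 0" "w \<in> carleson_region \<xi> s" "w \<in> carleson_region \<xi>' t"
    and st: "s \<le> t"
  shows "carleson_region \<xi> s \<subseteq> carleson_region \<xi>' (18 * t)"
proof
  fix v assume v: "v \<in> carleson_region \<xi> s"
  have nv: "norm v < 1" "norm w < 1" using v w by (auto simp: carleson_region_iff)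
  have \<eta>: "norm (sgn w) = 1" using w by (simp add: norm_sgn)
  have "cmod (1 - herm \<xi> (sgn w)) < 2 * t" "cmod (1 - herm \<xi>' (sgn w)) < 2 * t"
    using one_minus_herm_sgn_le(1)[of \<xi> w] one_minus_herm_sgn_le(1)[of \<xi>' w] w \<xi> nv st
    unfolding carleson_region_iff one_minus_herm_commute[of w] by auto
  then have d: "nonisotropic_dist \<xi> (sgn w) < sqrt (2 * t)" "nonisotropic_dist \<xi>' (sgn w) < sqrt (2 * t)"
    by (simp_all add: nonisotropic_dist_def)
  have "cmod (1 - herm v \<xi>) < 2 * t"
    using v st norm_ge_zero[of "1 - herm v \<xi>"] unfolding carleson_region_iff by linarith
  then have dv: "nonisotropic_dist v \<xi> < sqrt (2 * t)"
    by (simp add: nonisotropic_dist_def)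
  have "nonisotropic_dist v \<xi>' \<le> nonisotropic_dist v \<xi> + nonisotropic_dist \<xi>' \<xi>"
    using nv \<xi> by (intro nonisotropic_dist_triangle) auto
  also have "nonisotropic_dist \<xi>' \<xi> \<le> nonisotropic_dist \<xi>' (sgn w) + nonisotropic_dist \<xi> (sgn w)"
    using \<xi> \<eta> by (intro nonisotropic_dist_triangle) auto
  also have "nonisotropic_dist v \<xi> + \<dots> < 3 * sqrt (2 * t)"
    using d dv by simp
  also have "3 * sqrt (2 * t) = sqrt (18 * t)"
    using real_sqrt_mult[of 9 "2 * t"] by simp
  finally show "v \<in> carleson_region \<xi>' (18 * t)"
    using nv by (simp add: carleson_region_iff nonisotropic_dist_def)
qed

section \<open>Near and far parts of the potential\<close>

text \<open>M plays the role of \<lambda>; its finiteness encodes the integrability condition on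
  \<mu>.\<close>

locale ball_measure = finite_measure M for M :: "(complex ^ 'n) measure" +
  assumes sets_M: "sets M = sets (restrict_space borel (ball 0 1))"
begin

sublocale sphere: prob_space "sphere_measure :: (complex ^ 'n) measure"
  by (rule prob_space_sphere_measure)

sublocale P: pair_sigma_finite "sphere_measure :: (complex ^ 'n) measure" M ..

lemma space_M: "space M = ball 0 1"
  using sets_eq_imp_space_eq[OF sets_M] by (simp add: space_restrict_space)

lemma measurable_M_borel [measurable]: "(\<lambda>x. x) \<in> measurable M borel"
  unfolding measurable_cong_sets[OF sets_M refl] by (intro measurable_restrict_space1) simp

lemma measurable_pair_borel [measurable]:
  "fst \<in> measurable (sphere_measure \<Otimes>\<^sub>M M) borel" "snd \<in> measurable (sphere_measure \<Otimes>\<^sub>M M) borel"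
  by (rule measurable_compose[OF measurable_fst measurable_sphere_measure_borel])
    (rule measurable_compose[OF measurable_snd measurable_M_borel])

lemma carleson_region_sets [measurable]: "carleson_region \<xi> s \<in> sets M"
proof -
  have "carleson_region \<xi> s = (\<lambda>z. indicator (carleson_region \<xi> s) z :: ennreal) -` {1} \<inter> space M"
    by (auto simp: indicator_def carleson_region_iff space_M)
  also have "\<dots> \<in> sets M"
    by (rule measurable_sets[of _ M borel]) simp_all
  finally show ?thesis .
qed

abbreviation mass :: "complex ^ 'n \<Rightarrow> real \<Rightarrow> ennreal" where
  "mass \<xi> s \<equiv> emeasure M (carleson_region \<xi> s)"

lemma mass_eq: "mass \<xi> s = (\<integral>\<^sup>+w. indicator (carleson_region \<xi> s) w \<partial>M)"
  by simp

lemma borel_measurable_mass [measurable]: "(\<lambda>\<xi>. mass \<xi> s) \<in> borel_measurable sphere_measure"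
  unfolding mass_eq by (rule borel_measurable_nn_integral) (simp add: case_prod_unfold)

lemma mass_mono: "s \<le> t \<Longrightarrow> mass \<xi> s \<le> mass \<xi> t"
  by (intro emeasure_mono) (auto simp: carleson_region_iff)

text \<open>The dyadic sum is an integral against the finite geometric measure with weights
  \<open>2 powr (k * (\<gamma> - 2 * n))\<close>, so Jensen's inequality replaces Minkowski's.\<close>

lemma far_estimate:
  fixes p \<gamma> K :: real
  assumes p: "1 < p" and \<gamma>: "\<gamma> < 2 * real CARD('n)" and K: "0 \<le> K"
    and growth: "\<And>s. 0 < s \<Longrightarrow> (\<integral>\<^sup>+\<xi>. epowr (mass \<xi> s) p \<partial>sphere_measure) \<le> ennreal ((K * s powr \<gamma>) powr p)"
  obtains C where "0 \<le> C" "\<And>\<delta>. 0 < \<delta> \<Longrightarrow>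
    (\<integral>\<^sup>+\<xi>. epowr (\<Sum>k. ennreal (1 / (2 ^ k * \<delta>) ^ (2 * CARD('n))) * mass \<xi> (2 ^ (k + 2) * \<delta>)) p \<partial>sphere_measure)
      \<le> ennreal ((C * \<delta> powr (\<gamma> - 2 * real CARD('n))) powr p)"
proof -
  define N where "N = real CARD('n)"
  define \<rho> where "\<rho> = 2 powr (\<gamma> - 2 * N)"
  have \<rho>: "0 < \<rho>" "\<rho> < 1"
    using \<gamma> powr_less_mono[of "\<gamma> - 2 * N" 0 2] by (auto simp: \<rho>_def N_def)
  define A where "A = 1 / (1 - \<rho>)"
  have A: "0 < A" using \<rho> by (simp add: A_def)
  have sumA: "(\<Sum>k. ennreal (\<rho> ^ k)) = ennreal A"
    using \<rho> geometric_sums[of \<rho>] by (intro suminf_ennreal_eq) (auto simp: A_def)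
  define \<nu> where "\<nu> = density (count_space (UNIV :: nat set)) (\<lambda>k. ennreal (\<rho> ^ k))"
  have int_\<nu>: "(\<integral>\<^sup>+k. f k \<partial>\<nu>) = (\<Sum>k. ennreal (\<rho> ^ k) * f k)" for f :: "nat \<Rightarrow> ennreal"
    by (simp add: \<nu>_def nn_integral_density nn_integral_count_space_nat)
  have mass_\<nu>: "emeasure \<nu> (space \<nu>) = ennreal A"
    using int_\<nu>[of "\<lambda>_. 1"] by (simp add: sumA)
  show ?thesis
  proof (rule that[of "A * 4 powr \<gamma> * K"])
    show "0 \<le> A * 4 powr \<gamma> * K" using A K by simp
    fix \<delta> :: real assume \<delta>: "0 < \<delta>"
    \<comment> \<open>What is left of 1 / (2^k \<delta>)^(2 n) after the weight \<rho>^k is split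
      off. It cancels the growth 2^(k \<gamma>) of the mass bound, so the resulting estimate is
      uniform in k.\<close>
    define c where "c = (\<lambda>k::nat. 2 powr (- real k * \<gamma>) * \<delta> powr (- 2 * N))"
    define b where "b = (\<lambda>\<xi> k. ennreal (c k) * mass \<xi> (2 ^ (k + 2) * \<delta>))"
    have [measurable]: "(\<lambda>\<xi>. b \<xi> k) \<in> borel_measurable sphere_measure" for k
      unfolding b_def by measurable
    have c: "0 \<le> c k" for k by (simp add: c_def)
    have "1 / (2 ^ k * \<delta>) ^ (2 * CARD('n)) = \<rho> ^ k * c k" for k
    proof -
      have "1 / (2 ^ k * \<delta>) ^ (2 * CARD('n)) = (2 powr real k * \<delta>) powr (- 2 * N)"
        using \<delta> by (simp add: powr_realpow[symmetric] powr_minus_divide N_def)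
      also have "\<dots> = 2 powr (- 2 * N * real k) * \<delta> powr (- 2 * N)"
        using \<delta> by (simp add: powr_mult powr_powr mult_ac)
      also have "2 powr (- 2 * N * real k) = \<rho> ^ k * 2 powr (- real k * \<gamma>)"
        by (simp add: \<rho>_def powr_realpow[symmetric] powr_powr powr_add[symmetric] algebra_simps)
      finally show ?thesis by (simp add: c_def)
    qed
    then have "(\<Sum>k. ennreal (1 / (2 ^ k * \<delta>) ^ (2 * CARD('n))) * mass \<xi> (2 ^ (k + 2) * \<delta>)) = (\<integral>\<^sup>+k. b \<xi> k \<partial>\<nu>)" for \<xi>
      using \<rho> c by (simp add: int_\<nu> b_def ennreal_mult mult.assoc)
    then have "(\<integral>\<^sup>+\<xi>. epowr (\<Sum>k. ennreal (1 / (2 ^ k * \<delta>) ^ (2 * CARD('n))) * mass \<xi> (2 ^ (k + 2) * \<delta>)) p \<partial>sphere_measure)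
      = (\<integral>\<^sup>+\<xi>. epowr (\<integral>\<^sup>+k. b \<xi> k \<partial>\<nu>) p \<partial>sphere_measure)"
      by simp
    also have "\<dots> \<le> (\<integral>\<^sup>+\<xi>. epowr (emeasure \<nu> (space \<nu>)) (p - 1) * (\<integral>\<^sup>+k. epowr (b \<xi> k) p \<partial>\<nu>) \<partial>sphere_measure)"
    proof (intro nn_integral_mono nn_integral_powr_le p)
      show "b \<xi> \<in> borel_measurable \<nu>" for \<xi> by (simp add: \<nu>_def)
      show "emeasure \<nu> (space \<nu>) < \<infinity>" by (simp add: mass_\<nu>)
    qed
    also have "\<dots> = ennreal (A powr (p - 1)) * (\<Sum>k. ennreal (\<rho> ^ k) * (\<integral>\<^sup>+\<xi>. epowr (b \<xi> k) p \<partial>sphere_measure))"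
      using A by (simp add: int_\<nu> mass_\<nu> epowr_ennreal nn_integral_cmult nn_integral_suminf)
    also have "\<dots> \<le> ennreal (A powr (p - 1)) * (\<Sum>k. ennreal (\<rho> ^ k) * ennreal ((4 powr \<gamma> * K * \<delta> powr (\<gamma> - 2 * N)) powr p))"
    proof (intro mult_left_mono suminf_le summableI)
      fix k
      have "(\<integral>\<^sup>+\<xi>. epowr (b \<xi> k) p \<partial>sphere_measure)
        = ennreal (c k powr p) * (\<integral>\<^sup>+\<xi>. epowr (mass \<xi> (2 ^ (k + 2) * \<delta>)) p \<partial>sphere_measure)"
        unfolding b_def using p c by (intro nn_integral_epowr_cmult) auto
      also have "\<dots> \<le> ennreal (c k powr p) * ennreal ((K * (2 ^ (k + 2) * \<delta>) powr \<gamma>) powr p)"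
        using \<delta> by (intro mult_left_mono growth) auto
      also have "\<dots> = ennreal ((c k * (K * (2 ^ (k + 2) * \<delta>) powr \<gamma>)) powr p)"
        using c[of k] K by (simp add: powr_mult flip: ennreal_mult)
      also have "c k * (K * (2 ^ (k + 2) * \<delta>) powr \<gamma>) = 4 powr \<gamma> * K * \<delta> powr (\<gamma> - 2 * N)"
      proof -
        have "(2 ^ (k + 2) * \<delta>) powr \<gamma> = 4 powr \<gamma> * (2 powr (real k * \<gamma>) * \<delta> powr \<gamma>)"
          using \<delta> by (simp add: powr_mult power_add powr_realpow[symmetric] powr_powr mult_ac)
        moreover have "2 powr (- real k * \<gamma>) * 2 powr (real k * \<gamma>) = 1"
          by (simp flip: powr_add)
        moreover have "\<delta> powr (- 2 * N) * \<delta> powr \<gamma> = \<delta> powr (\<gamma> - 2 * N)"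
          by (simp flip: powr_add)
        ultimately show ?thesis
          unfolding c_def by (simp add: mult_ac)
      qed
      finally show "(\<integral>\<^sup>+\<xi>. epowr (b \<xi> k) p \<partial>sphere_measure) \<le> ennreal ((4 powr \<gamma> * K * \<delta> powr (\<gamma> - 2 * N)) powr p)" .
    qed auto
    also have "\<dots> = ennreal (A powr (p - 1) * A * (4 powr \<gamma> * K * \<delta> powr (\<gamma> - 2 * N)) powr p)"
      using A by (simp add: sumA ennreal_mult mult.assoc)
    also have "A powr (p - 1) * A = A powr p"
      using A by (simp add: powr_diff)
    also have "A powr p * (4 powr \<gamma> * K * \<delta> powr (\<gamma> - 2 * N)) powr p = (A * 4 powr \<gamma> * K * \<delta> powr (\<gamma> - 2 * N)) powr p"
      using A K by (simp add: powr_mult mult.assoc)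
    finally show "(\<integral>\<^sup>+\<xi>. epowr (\<Sum>k. ennreal (1 / (2 ^ k * \<delta>) ^ (2 * CARD('n))) * mass \<xi> (2 ^ (k + 2) * \<delta>)) p \<partial>sphere_measure)
      \<le> ennreal ((A * 4 powr \<gamma> * K * \<delta> powr (\<gamma> - 2 * real CARD('n))) powr p)"
      unfolding N_def .
  qed
qed

text \<open>Jensen's inequality for M restricted to the region of radius 13 \<delta>, which supports
  the kernel; thus the mass of that region appears in place of the total mass.\<close>

lemma near_integral_le:
  fixes p :: real
  assumes p: "1 < p" and \<xi>: "norm \<xi> = 1"
  shows "epowr (\<integral>\<^sup>+w. near_kernel \<delta> \<xi> w \<partial>M) p
    \<le> (\<integral>\<^sup>+w. epowr (mass \<xi> (13 * \<delta>)) (p - 1) * epowr (near_kernel \<delta> \<xi> w) p \<partial>M)"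
proof -
  let ?C = "carleson_region \<xi> (13 * \<delta>)"
  let ?D = "density M (indicator ?C)"
  have D: "emeasure ?D (space ?D) = mass \<xi> (13 * \<delta>)"
    using sets.sets_into_space[OF carleson_region_sets] by (simp add: emeasure_density Int_absorb2 nn_integral_set_ennreal)
  have "(\<integral>\<^sup>+w. near_kernel \<delta> \<xi> w \<partial>M) = (\<integral>\<^sup>+w. near_kernel \<delta> \<xi> w \<partial>?D)"
    by (subst nn_integral_density)
      (auto intro!: nn_integral_cong simp: indicator_carleson_region near_kernel_def space_M)
  also have "epowr \<dots> p \<le> epowr (mass \<xi> (13 * \<delta>)) (p - 1) * (\<integral>\<^sup>+w. epowr (near_kernel \<delta> \<xi> w) p \<partial>?D)"
    unfolding D[symmetric] by (rule nn_integral_powr_le[OF p]) (use D in \<open>simp_all add: less_top[symmetric]\<close>)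
  also have "(\<integral>\<^sup>+w. epowr (near_kernel \<delta> \<xi> w) p \<partial>?D) = (\<integral>\<^sup>+w. epowr (near_kernel \<delta> \<xi> w) p \<partial>M)"
    by (subst nn_integral_density)
      (auto intro!: nn_integral_cong simp: indicator_carleson_region near_kernel_def space_M)
  finally show ?thesis
    by (simp add: nn_integral_cmult)
qed

lemma near_estimate:
  fixes p \<gamma> K :: real
  assumes n: "CARD('n) > 1" and p: "1 < p" "p < (2 * real CARD('n) - 1) / (2 * (real CARD('n) - 1))"
    and K: "0 \<le> K"
    and growth: "\<And>s. 0 < s \<Longrightarrow> (\<integral>\<^sup>+\<xi>. epowr (mass \<xi> s) p \<partial>sphere_measure) \<le> ennreal ((K * s powr \<gamma>) powr p)"
  obtains C where "0 \<le> C" "\<And>\<delta>. 0 < \<delta> \<Longrightarrow> \<delta> \<le> 1 \<Longrightarrow>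
    (\<integral>\<^sup>+\<xi>. epowr (\<integral>\<^sup>+w. near_kernel \<delta> \<xi> w \<partial>M) p \<partial>sphere_measure) \<le> ennreal ((C * \<delta> powr \<gamma>) powr p)"
proof -
  obtain A where A: "0 \<le> A" "\<And>\<delta> (w :: complex ^ 'n). 0 < \<delta> \<Longrightarrow>
      (\<integral>\<^sup>+\<xi>. epowr (near_kernel \<delta> \<xi> w) p \<partial>sphere_measure) \<le> ennreal (A * \<delta> ^ CARD('n))"
    using near_kernel_sphere_integral[OF n p] by blast
  obtain c where c: "0 < c"
    "\<And>\<delta> (w :: complex ^ 'n). 0 < \<delta> \<Longrightarrow> \<delta> \<le> 1 \<Longrightarrow> w \<noteq> 0 \<Longrightarrow> norm w < 1 \<Longrightarrow> 1 - norm w \<le> 6 * \<delta> \<Longrightarrow>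
      ennreal (c * \<delta> ^ CARD('n)) \<le> (\<integral>\<^sup>+\<xi>. indicator (carleson_region \<xi> (14 * \<delta>)) w \<partial>sphere_measure)"
    using carleson_region_sphere_integral[OF n] by blast
  show ?thesis
  proof (rule that[of "(A / c) powr (1 / p) * K * 252 powr \<gamma>"])
    show "0 \<le> (A / c) powr (1 / p) * K * 252 powr \<gamma>" using K by simp
    fix \<delta> :: real assume \<delta>: "0 < \<delta>" "\<delta> \<le> 1"
    let ?k = "\<lambda>\<xi> w. epowr (near_kernel \<delta> \<xi> w) p"
    let ?m = "\<lambda>\<xi>. epowr (mass \<xi> (13 * \<delta>)) (p - 1)"
    \<comment> \<open>252 = 18 * 14, the enlargement in
      \<open>carleson_region_subset\<close>.\<close>
    let ?M = "\<lambda>\<xi>. epowr (mass \<xi> (252 * \<delta>)) (p - 1)"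
    define J where "J = (\<lambda>w. \<integral>\<^sup>+\<xi>. indicator (carleson_region \<xi> (14 * \<delta>)) w * ?M \<xi> \<partial>sphere_measure)"
    define d where "d = c * \<delta> ^ CARD('n)"
    have d: "0 < d" using c \<delta> by (simp add: d_def)
    \<comment> \<open>The averaging step: d is a lower bound for the measure of the centres \<xi>'
      with w in their region of radius 14 \<delta>, and for each of them engulfing gives
      \<open>?m \<xi> \<le> ?M \<xi>'\<close>. On the right only the kernel still depends on
      \<xi>.\<close>
    have J: "?m \<xi> * ?k \<xi> w * ennreal d \<le> J w * ?k \<xi> w"
      if w: "w \<in> space M" and \<xi>: "\<xi> \<in> space sphere_measure" for w \<xi>
    proof (cases "near_kernel \<delta> \<xi> w = 0")
      case False
      then have nk: "w \<noteq> 0" "cmod (1 - herm w \<xi>) < 13 * \<delta>" "1 - norm w \<le> 6 * \<delta>"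
        by (auto simp: near_kernel_def split: if_splits)
      have w1: "norm w < 1" and \<xi>1: "norm \<xi> = 1" using w \<xi> by (auto simp: space_M space_sphere_measure)
      have "?m \<xi> * ennreal d \<le> ?m \<xi> * (\<integral>\<^sup>+\<xi>'. indicator (carleson_region \<xi>' (14 * \<delta>)) w \<partial>sphere_measure)"
        unfolding d_def using nk w1 \<delta> by (intro mult_left_mono c(2)) auto
      also have "\<dots> = (\<integral>\<^sup>+\<xi>'. indicator (carleson_region \<xi>' (14 * \<delta>)) w * ?m \<xi> \<partial>sphere_measure)"
        by (simp add: nn_integral_multc mult.commute)
      also have "\<dots> \<le> J w"
        unfolding J_def
      proof (rule nn_integral_mono)
        fix \<xi>' assume "\<xi>' \<in> space (sphere_measure :: (complex ^ 'n) measure)"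
        then have \<xi>': "norm \<xi>' = 1" by (simp add: space_sphere_measure)
        show "indicator (carleson_region \<xi>' (14 * \<delta>)) w * ?m \<xi>
          \<le> indicator (carleson_region \<xi>' (14 * \<delta>)) w * ?M \<xi>'"
        proof (cases "w \<in> carleson_region \<xi>' (14 * \<delta>)")
          case True
          have "carleson_region \<xi> (13 * \<delta>) \<subseteq> carleson_region \<xi>' (18 * (14 * \<delta>))"
            using True nk w1 \<xi>1 \<xi>' \<delta> by (intro carleson_region_subset[of \<xi> \<xi>' w]) (auto simp: carleson_region_iff)
          then have "mass \<xi> (13 * \<delta>) \<le> mass \<xi>' (252 * \<delta>)"
            by (intro emeasure_mono) simp_all
          then show ?thesis
            using p by (intro mult_left_mono epowr_mono) auto
        qed simp
      qed
      finally show ?thesis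
        by (metis (no_types, lifting) mult.assoc mult.commute mult_right_mono zero_le)
    qed simp
    have inner: "(\<integral>\<^sup>+\<xi>. ?m \<xi> * ?k \<xi> w \<partial>sphere_measure) \<le> ennreal (A / c) * J w" if w: "w \<in> space M" for w
    proof -
      have "(\<integral>\<^sup>+\<xi>. ?m \<xi> * ?k \<xi> w \<partial>sphere_measure) * ennreal d = (\<integral>\<^sup>+\<xi>. ?m \<xi> * ?k \<xi> w * ennreal d \<partial>sphere_measure)"
        by (simp add: nn_integral_multc)
      also have "\<dots> \<le> (\<integral>\<^sup>+\<xi>. J w * ?k \<xi> w \<partial>sphere_measure)"
        using J[OF w] by (intro nn_integral_mono)
      also have "\<dots> = J w * (\<integral>\<^sup>+\<xi>. ?k \<xi> w \<partial>sphere_measure)"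
        by (simp add: nn_integral_cmult)
      also have "\<dots> \<le> J w * ennreal (A * \<delta> ^ CARD('n))"
        using \<delta> by (intro mult_left_mono A(2)) auto
      \<comment> \<open>The kernel integral and d are both multiples of \<delta>^n, so their
        quotient is the constant A / c.\<close>
      finally have "(\<integral>\<^sup>+\<xi>. ?m \<xi> * ?k \<xi> w \<partial>sphere_measure) * ennreal d * ennreal (1 / d)
          \<le> J w * ennreal (A * \<delta> ^ CARD('n)) * ennreal (1 / d)"
        by (intro mult_right_mono) auto
      moreover have "ennreal d * ennreal (1 / d) = 1"
        using d by (simp flip: ennreal_mult)
      moreover have "ennreal (A * \<delta> ^ CARD('n)) * ennreal (1 / d) = ennreal (A / c)"
        using d A(1) \<delta> c(1) by (simp add: d_def flip: ennreal_mult)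
      ultimately show ?thesis
        by (simp only: mult.assoc mult_1_right) (simp only: mult.commute)
    qed
    have [measurable]: "(\<lambda>x. ?m (fst x)) \<in> borel_measurable (sphere_measure \<Otimes>\<^sub>M M)"
      "(\<lambda>x. ?M (fst x)) \<in> borel_measurable (sphere_measure \<Otimes>\<^sub>M M)"
      by measurable
    have "(\<integral>\<^sup>+\<xi>. epowr (\<integral>\<^sup>+w. near_kernel \<delta> \<xi> w \<partial>M) p \<partial>sphere_measure)
      \<le> (\<integral>\<^sup>+\<xi>. \<integral>\<^sup>+w. ?m \<xi> * ?k \<xi> w \<partial>M \<partial>sphere_measure)"
      by (intro nn_integral_mono near_integral_le p(1)) (simp add: space_sphere_measure)
    also have "\<dots> = (\<integral>\<^sup>+w. \<integral>\<^sup>+\<xi>. ?m \<xi> * ?k \<xi> w \<partial>sphere_measure \<partial>M)"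
      by (rule P.Fubini'[symmetric]) (simp add: case_prod_unfold)
    also have "\<dots> \<le> (\<integral>\<^sup>+w. ennreal (A / c) * J w \<partial>M)"
      by (intro nn_integral_mono inner)
    also have "\<dots> = ennreal (A / c) * (\<integral>\<^sup>+w. J w \<partial>M)"
    proof (rule nn_integral_cmult)
      show "J \<in> borel_measurable M"
        unfolding J_def
        by (rule sphere.borel_measurable_nn_integral) (subst measurable_pair_swap_iff, simp add: case_prod_unfold)
    qed
    also have "(\<integral>\<^sup>+w. J w \<partial>M) = (\<integral>\<^sup>+\<xi>. \<integral>\<^sup>+w. indicator (carleson_region \<xi> (14 * \<delta>)) w * ?M \<xi> \<partial>M \<partial>sphere_measure)"
      unfolding J_def by (rule P.Fubini') (simp add: case_prod_unfold)
    also have "\<dots> = (\<integral>\<^sup>+\<xi>. mass \<xi> (14 * \<delta>) * ?M \<xi> \<partial>sphere_measure)"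
      by (simp add: nn_integral_multc)
    also have "\<dots> \<le> (\<integral>\<^sup>+\<xi>. epowr (mass \<xi> (252 * \<delta>)) p \<partial>sphere_measure)"
    proof (rule nn_integral_mono)
      fix \<xi>
      \<comment> \<open>The integral of J has produced a mass to the first power; enlarging its
        radius to 252 \<delta> lets it combine with the exponent p - 1 into p.\<close>
      have "mass \<xi> (14 * \<delta>) * ?M \<xi> \<le> epowr (mass \<xi> (252 * \<delta>)) 1 * ?M \<xi>"
        using \<delta> by (intro mult_right_mono) (auto intro!: mass_mono)
      also have "\<dots> = epowr (mass \<xi> (252 * \<delta>)) p"
        using p by (subst epowr_add[symmetric]) auto
      finally show "mass \<xi> (14 * \<delta>) * ?M \<xi> \<le> epowr (mass \<xi> (252 * \<delta>)) p" .
    qed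
    also have "\<dots> \<le> ennreal ((K * (252 * \<delta>) powr \<gamma>) powr p)"
      using \<delta> by (intro growth) simp
    also have "ennreal (A / c) * \<dots> = ennreal (((A / c) powr (1 / p) * K * 252 powr \<gamma> * \<delta> powr \<gamma>) powr p)"
    proof -
      have "((A / c) powr (1 / p) * K * 252 powr \<gamma> * \<delta> powr \<gamma>) powr p
        = ((A / c) powr (1 / p)) powr p * (K * (252 * \<delta>) powr \<gamma>) powr p"
        using K \<delta> by (simp add: powr_mult mult_ac)
      also have "((A / c) powr (1 / p)) powr p = A / c"
        using p A c by (simp add: powr_powr)
      finally show ?thesis
        using A(1) c(1) by (subst ennreal_mult[symmetric]) auto
    qed
    finally show "(\<integral>\<^sup>+\<xi>. epowr (\<integral>\<^sup>+w. near_kernel \<delta> \<xi> w \<partial>M) p \<partial>sphere_measure)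
      \<le> ennreal (((A / c) powr (1 / p) * K * 252 powr \<gamma> * \<delta> powr \<gamma>) powr p)"
      by (simp add: mult_left_mono)
  qed
qed

end

section \<open>Pointwise bounds for the Green's function\<close>

lemma one_minus_norm_ball_aut:
  fixes z w :: "complex ^ 'n"
  assumes "norm z < 1" "norm w < 1"
  shows "1 - (norm (ball_aut w z))\<^sup>2
      = (1 - (norm z)\<^sup>2) * (1 - (norm w)\<^sup>2) / (cmod (1 - herm z w))\<^sup>2"
    and "norm (ball_aut w z) \<le> 1"
proof -
  show eq: "1 - (norm (ball_aut w z))\<^sup>2
      = (1 - (norm z)\<^sup>2) * (1 - (norm w)\<^sup>2) / (cmod (1 - herm z w))\<^sup>2"
    by (simp add: norm_ball_aut[OF assms])
  have "0 \<le> 1 - (norm (ball_aut w z))\<^sup>2"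
    unfolding eq using assms by (intro divide_nonneg_nonneg mult_nonneg_nonneg) (auto simp: power_le_one)
  then show "norm (ball_aut w z) \<le> 1"
    by (simp add: power_le_one_iff abs_square_le_1)
qed

lemma one_minus_square_bounds:
  fixes s :: real
  assumes "0 \<le> s" "s \<le> 1"
  shows "1 - s \<le> 1 - s\<^sup>2" "1 - s\<^sup>2 \<le> 2 * (1 - s)"
proof -
  show "1 - s \<le> 1 - s\<^sup>2" using assms by (simp add: power2_eq_square mult_left_le)
  show "1 - s\<^sup>2 \<le> 2 * (1 - s)"
    using zero_le_power2[of "s - 1"] by (simp add: power2_eq_square algebra_simps)
qed

text \<open>For z = (1 - \<delta>) \<xi> and w in the region, |1 - \<open>herm z w\<close>| <= 2
  \<delta>, so 1 - |\<open>ball_aut w z\<close>|^2 is at least (1 - |w|) / (4 \<delta>);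
  \<open>green_radial_ge\<close> then involves its n-th power.\<close>

lemma green_lower_bound:
  obtains c :: real where "0 < c"
    "\<And>\<delta> \<xi> (w :: complex ^ 'n). 0 < \<delta> \<Longrightarrow> \<delta> < 1 \<Longrightarrow> norm \<xi> = 1 \<Longrightarrow> w \<in> carleson_region \<xi> \<delta> \<Longrightarrow>
      ennreal (c / \<delta> ^ CARD('n)) * ennreal ((1 - norm w) ^ CARD('n)) \<le> green ((1 - \<delta>) *\<^sub>R \<xi>) w"
proof -
  define c0 where "c0 = (real CARD('n) + 1) / (2 * real CARD('n)) / (2 * real CARD('n))"
  have c0: "0 < c0" by (auto simp: c0_def intro!: divide_pos_pos add_pos_pos)
  show ?thesis
  proof (rule that[of "c0 / 4 ^ CARD('n)"])
    show "0 < c0 / 4 ^ CARD('n)" using c0 by simp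
    fix \<delta> and \<xi> w :: "complex ^ 'n"
    assume \<delta>: "0 < \<delta>" "\<delta> < 1" and \<xi>: "norm \<xi> = 1" and w: "w \<in> carleson_region \<xi> \<delta>"
    let ?z = "(1 - \<delta>) *\<^sub>R \<xi>"
    define D where "D = cmod (1 - herm ?z w)"
    have nw: "norm w < 1" and z: "norm ?z = 1 - \<delta>"
      using w \<xi> \<delta> by (auto simp: carleson_region_iff)
    have "cmod (1 - herm \<xi> w) < \<delta>"
      using w by (simp add: carleson_region_iff one_minus_herm_commute[of \<xi>])
    then have D2: "D \<le> 2 * \<delta>"
      using one_minus_herm_radius(1)[of \<xi> w "1 - \<delta>"] \<xi> nw \<delta> unfolding D_def by simp
    have "\<delta> \<le> D"
      unfolding D_def using one_minus_herm_ge(1)[of ?z w] nw z \<delta> by simp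
    then have D0: "0 < D" using \<delta> by linarith
    have "(1 - norm w) / (4 * \<delta>) = \<delta> * (1 - norm w) / (2 * \<delta>)\<^sup>2"
      using \<delta> by (simp add: power2_eq_square)
    also have "\<dots> \<le> (1 - (norm ?z)\<^sup>2) * (1 - (norm w)\<^sup>2) / D\<^sup>2"
    proof (rule frac_le)
      show "\<delta> * (1 - norm w) \<le> (1 - (norm ?z)\<^sup>2) * (1 - (norm w)\<^sup>2)"
        using one_minus_square_bounds(1)[of "norm ?z"] one_minus_square_bounds(1)[of "norm w"] nw z \<delta>
        by (intro mult_mono) auto
      show "D\<^sup>2 \<le> (2 * \<delta>)\<^sup>2" using D2 D0 by (intro power_mono) auto
      show "0 \<le> (1 - (norm ?z)\<^sup>2) * (1 - (norm w)\<^sup>2)"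
        using nw z \<delta> by (intro mult_nonneg_nonneg) (auto simp: power_le_one)
    qed (use D0 in auto)
    also have "\<dots> = 1 - (norm (ball_aut w ?z))\<^sup>2"
      unfolding D_def using one_minus_norm_ball_aut(1)[of ?z w] nw z \<delta> by simp
    finally have X: "(1 - norm w) / (4 * \<delta>) \<le> 1 - (norm (ball_aut w ?z))\<^sup>2" .
    have "ennreal (c0 / 4 ^ CARD('n) / \<delta> ^ CARD('n)) * ennreal ((1 - norm w) ^ CARD('n))
      = ennreal (c0 * ((1 - norm w) / (4 * \<delta>)) ^ CARD('n))"
      using c0 \<delta> nw by (simp add: power_divide power_mult_distrib flip: ennreal_mult)
    also have "\<dots> \<le> ennreal (c0 * (1 - (norm (ball_aut w ?z))\<^sup>2) ^ CARD('n))"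
      using X c0 nw \<delta> by (intro ennreal_leI mult_left_mono power_mono) auto
    also have "\<dots> \<le> green ?z w"
      unfolding green_def c0_def
      using one_minus_norm_ball_aut(2)[of ?z w] nw z \<delta> by (intro green_radial_ge) auto
    finally show "ennreal (c0 / 4 ^ CARD('n) / \<delta> ^ CARD('n)) * ennreal ((1 - norm w) ^ CARD('n)) \<le> green ?z w" .
  qed
qed

text \<open>One term suffices. If N = k + 1 is the first index with D < 2^N \<delta>, which is
  positive because \<delta> <= D, then 2^k \<delta> <= D bounds the coefficient and 2 D < 2^(k + 2)
  \<delta> puts w in the region. One extra power of 2 in the radius comes from minimality of N, the
  other from the factor 2 in the hypothesis.\<close>

lemma dyadic_dominates:
  fixes \<xi> w :: "complex ^ 'n"
  assumes \<delta>: "0 < \<delta>" "\<delta> \<le> D" and w: "norm w < 1" "cmod (1 - herm w \<xi>) \<le> 2 * D"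
  shows "ennreal (1 / D ^ m) \<le> (\<Sum>k. ennreal (1 / (2 ^ k * \<delta>) ^ m) * indicator (carleson_region \<xi> (2 ^ (k + 2) * \<delta>)) w)"
proof -
  define N where "N = (LEAST N. D < 2 ^ N * \<delta>)"
  obtain N' where "D / \<delta> < 2 ^ N'"
    using real_arch_pow[of 2 "D / \<delta>"] by auto
  then have "D < 2 ^ N' * \<delta>" using \<delta> by (simp add: field_simps)
  then have N: "D < 2 ^ N * \<delta>"
    unfolding N_def by (rule LeastI)
  then obtain k where k: "N = Suc k"
    using \<delta> by (cases N) auto
  have kD: "2 ^ k * \<delta> \<le> D"
    using not_less_Least[of k "\<lambda>N. D < 2 ^ N * \<delta>"] k unfolding N_def by simp
  have "ennreal (1 / D ^ m) \<le> ennreal (1 / (2 ^ k * \<delta>) ^ m)"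
    using kD \<delta> by (intro ennreal_leI frac_le power_mono) auto
  also have "\<dots> = ennreal (1 / (2 ^ k * \<delta>) ^ m) * indicator (carleson_region \<xi> (2 ^ (k + 2) * \<delta>)) w"
    using w N k by (simp add: indicator_carleson_region)
  also have "\<dots> \<le> (\<Sum>k. ennreal (1 / (2 ^ k * \<delta>) ^ m) * indicator (carleson_region \<xi> (2 ^ (k + 2) * \<delta>)) w)"
  proof -
    have "t k \<le> (\<Sum>k. t k)" for t :: "nat \<Rightarrow> ennreal"
      using sum_le_suminf[of t "{k}"] by simp
    then show ?thesis .
  qed
  finally show ?thesis .
qed

text \<open>The split is at norm 1/2 of \<open>ball_aut\<close>. In the near case (1 - |w|)^n is
  inserted at the price of (6 / \<delta>)^n, since there \<delta> <= 6 (1 - |w|). In the far case 1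
  - |\<open>ball_aut\<close>|^2 is at most 4 \<delta> (1 - |w|) / D^2, and its n-th power contains 1
  / D^(2 n), which the dyadic sum dominates.\<close>

lemma green_upper_bound:
  assumes n: "CARD('n) > 1"
  obtains C :: real where "0 < C"
    "\<And>r \<xi> (w :: complex ^ 'n). 1 / 2 \<le> r \<Longrightarrow> r < 1 \<Longrightarrow> norm \<xi> = 1 \<Longrightarrow> norm w < 1 \<Longrightarrow>
      green (r *\<^sub>R \<xi>) w \<le> ennreal ((1 - norm w) ^ CARD('n)) *
        (ennreal (C / (1 - r) ^ CARD('n)) * near_kernel (1 - r) \<xi> w
        + ennreal (C * (1 - r) ^ CARD('n)) * (\<Sum>k. ennreal (1 / (2 ^ k * (1 - r)) ^ (2 * CARD('n)))
             * indicator (carleson_region \<xi> (2 ^ (k + 2) * (1 - r))) w))"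
proof -
  define N where "N = CARD('n)"
  define c1 where "c1 = (real N + 1) / (2 * real N)"
  have N: "0 < N" using n by (simp add: N_def)
  have c1: "0 < c1" using N by (auto simp: c1_def intro!: divide_pos_pos add_pos_pos)
  define Cn where "Cn = c1 * 4 ^ (N - 1) * 6 ^ N"
  define Cf where "Cf = 4 ^ N * c1 / (2 * real N) * 4 ^ N"
  have C: "0 < Cn" "0 < Cf" using c1 N by (auto simp: Cn_def Cf_def)
  show ?thesis
  proof (rule that[of "Cn + Cf"])
    show "0 < Cn + Cf" using C by simp
    fix r :: real and \<xi> w :: "complex ^ 'n"
    assume r: "1 / 2 \<le> r" "r < 1" and \<xi>: "norm \<xi> = 1" and w: "norm w < 1"
    let ?z = "r *\<^sub>R \<xi>"
    define \<delta> where "\<delta> = 1 - r"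
    have \<delta>: "0 < \<delta>" using r by (simp add: \<delta>_def)
    define f where "f = ennreal ((1 - norm w) ^ N)"
    define S where "S = (\<Sum>k. ennreal (1 / (2 ^ k * \<delta>) ^ (2 * N)) * indicator (carleson_region \<xi> (2 ^ (k + 2) * \<delta>)) w :: ennreal)"
    have z: "norm ?z = r" using r \<xi> by simp
    have \<phi>1: "norm (ball_aut w ?z) \<le> 1"
      using one_minus_norm_ball_aut(2)[of ?z w] w z r by simp
    have "green ?z w \<le> f * (ennreal ((Cn + Cf) / \<delta> ^ N) * near_kernel \<delta> \<xi> w + ennreal ((Cn + Cf) * \<delta> ^ N) * S)"
    proof (cases "norm (ball_aut w ?z) < 1 / 2")
      case True
      note near = near_kernel_lower[OF n r \<xi> w True]
      have "green ?z w \<le> ennreal c1 * inverse (ennreal (norm (ball_aut w ?z) ^ (2 * N - 2)))"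
        unfolding green_def c1_def N_def using \<phi>1 n by (rule green_radial_le_near)
      also have "\<dots> \<le> ennreal c1 * (ennreal (4 ^ (N - 1)) * near_kernel \<delta> \<xi> w)"
        unfolding N_def \<delta>_def by (intro mult_left_mono near(1)) auto
      also have "\<dots> = 1 * (ennreal c1 * ennreal (4 ^ (N - 1)) * near_kernel \<delta> \<xi> w)"
        by (simp add: mult.assoc)
      also have "\<dots> \<le> ennreal ((6 / \<delta>) ^ N * (1 - norm w) ^ N) * (ennreal c1 * ennreal (4 ^ (N - 1)) * near_kernel \<delta> \<xi> w)"
      proof (rule mult_right_mono)
        have "1 ^ N \<le> (6 / \<delta> * (1 - norm w)) ^ N"
          using near(2) \<delta> by (intro power_mono) (auto simp: \<delta>_def field_simps)
        then show "1 \<le> ennreal ((6 / \<delta>) ^ N * (1 - norm w) ^ N)"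
          unfolding power_mult_distrib by simp
      qed simp
      also have "\<dots> = f * (ennreal (Cn / \<delta> ^ N) * near_kernel \<delta> \<xi> w)"
      proof -
        have "ennreal ((6 / \<delta>) ^ N * (1 - norm w) ^ N) * ennreal c1 * ennreal (4 ^ (N - 1))
          = ennreal ((6 / \<delta>) ^ N * (1 - norm w) ^ N * c1 * 4 ^ (N - 1))"
          using c1 \<delta> w by (simp add: ennreal_mult)
        also have "(6 / \<delta>) ^ N * (1 - norm w) ^ N * c1 * 4 ^ (N - 1) = (1 - norm w) ^ N * (Cn / \<delta> ^ N)"
          by (simp add: Cn_def power_divide mult_ac)
        also have "ennreal \<dots> = f * ennreal (Cn / \<delta> ^ N)"
          using w C \<delta> unfolding f_def by (intro ennreal_mult) auto
        finally show ?thesis by (simp only: mult.assoc[symmetric])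
      qed
      also have "\<dots> \<le> f * (ennreal ((Cn + Cf) / \<delta> ^ N) * near_kernel \<delta> \<xi> w)"
        using C \<delta> by (intro mult_left_mono mult_right_mono ennreal_leI divide_right_mono) auto
      also have "\<dots> \<le> f * (ennreal ((Cn + Cf) / \<delta> ^ N) * near_kernel \<delta> \<xi> w + ennreal ((Cn + Cf) * \<delta> ^ N) * S)"
        by (intro mult_left_mono) auto
      finally show ?thesis .
    next
      case False
      define D where "D = cmod (1 - herm ?z w)"
      have D: "\<delta> \<le> D"
        unfolding D_def \<delta>_def using one_minus_herm_ge(1)[of ?z w] w z r by simp
      have D0: "0 < D" using D \<delta> by linarith
      have Ds: "cmod (1 - herm w \<xi>) \<le> 2 * D"
        unfolding D_def one_minus_herm_commute[of w] using one_minus_herm_radius(2)[of \<xi> w r] \<xi> w r by simp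
      define X where "X = 1 - (norm (ball_aut w ?z))\<^sup>2"
      have X: "X = (1 - r\<^sup>2) * (1 - (norm w)\<^sup>2) / D\<^sup>2"
        unfolding X_def D_def using one_minus_norm_ball_aut(1)[of ?z w] w z r by simp
      have X0: "0 \<le> X" using \<phi>1 by (simp add: X_def power_le_one)
      have "X \<le> (2 * \<delta>) * (2 * (1 - norm w)) / D\<^sup>2"
        unfolding X \<delta>_def
        using one_minus_square_bounds(2)[of r] one_minus_square_bounds(2)[of "norm w"] r w
        by (intro divide_right_mono mult_mono) (auto simp: power_le_one)
      then have "X ^ N \<le> ((2 * \<delta>) * (2 * (1 - norm w)) / D\<^sup>2) ^ N"
        using X0 by (rule power_mono)
      also have "\<dots> = 4 ^ N * \<delta> ^ N * (1 - norm w) ^ N * (1 / D ^ (2 * N))"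
        by (simp add: power_divide power_mult_distrib power_mult[symmetric] mult_ac)
          (simp add: power_mult_distrib[symmetric])
      finally have XN: "X ^ N \<le> 4 ^ N * \<delta> ^ N * (1 - norm w) ^ N * (1 / D ^ (2 * N))" .
      have "green ?z w \<le> ennreal (4 ^ N * c1 / (2 * real N) * X ^ N)"
        unfolding green_def c1_def N_def X_def using \<phi>1 False by (intro green_radial_le_far) auto
      also have "\<dots> \<le> ennreal (4 ^ N * c1 / (2 * real N) * (4 ^ N * \<delta> ^ N * (1 - norm w) ^ N * (1 / D ^ (2 * N))))"
        using c1 by (intro ennreal_leI mult_left_mono XN) auto
      also have "4 ^ N * c1 / (2 * real N) * (4 ^ N * \<delta> ^ N * (1 - norm w) ^ N * (1 / D ^ (2 * N)))
        = (1 - norm w) ^ N * ((Cf * \<delta> ^ N) * (1 / D ^ (2 * N)))"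
        by (simp add: Cf_def mult_ac)
      also have "ennreal \<dots> = f * (ennreal (Cf * \<delta> ^ N) * ennreal (1 / D ^ (2 * N)))"
        using w C \<delta> D0 unfolding f_def
        by (subst ennreal_mult, simp, simp, subst ennreal_mult [of "Cf * \<delta> ^ N"]) simp_all
      also have "\<dots> \<le> f * (ennreal ((Cn + Cf) * \<delta> ^ N) * S)"
        unfolding S_def using C \<delta>
        by (intro mult_left_mono mult_mono ennreal_leI mult_right_mono dyadic_dominates D w Ds) auto
      also have "\<dots> \<le> f * (ennreal ((Cn + Cf) / \<delta> ^ N) * near_kernel \<delta> \<xi> w + ennreal ((Cn + Cf) * \<delta> ^ N) * S)"
        by (intro mult_left_mono) auto
      finally show ?thesis .
    qed
    then show "green ?z w \<le> ennreal ((1 - norm w) ^ CARD('n)) *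
        (ennreal ((Cn + Cf) / (1 - r) ^ CARD('n)) * near_kernel (1 - r) \<xi> w
        + ennreal ((Cn + Cf) * (1 - r) ^ CARD('n)) * (\<Sum>k. ennreal (1 / (2 ^ k * (1 - r)) ^ (2 * CARD('n)))
             * indicator (carleson_region \<xi> (2 ^ (k + 2) * (1 - r))) w))"
      unfolding f_def S_def N_def \<delta>_def .
  qed
qed

section \<open>The equivalence\<close>

text \<open>Finiteness follows from 1 - |w| <= 1 - |w|^2. The second part transfers integrals
  between \<mu> and \<lambda>; for this the bounds on \<open>green\<close> carry the factor (1 -
  |w|)^n.\<close>

lemma ball_measure_weighted_measure:
  fixes \<mu> :: "(complex ^ 'n) measure"
  assumes sets: "sets \<mu> = sets (restrict_space borel (ball 0 1))"
    and fin: "(\<integral>\<^sup>+w. ennreal ((1 - (norm w)\<^sup>2) ^ CARD('n)) \<partial>\<mu>) < \<infinity>"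
  shows "ball_measure (weighted_measure \<mu>)"
    and "F \<in> borel_measurable borel \<Longrightarrow>
      (\<integral>\<^sup>+w. F w \<partial>weighted_measure \<mu>) = (\<integral>\<^sup>+w. ennreal ((1 - norm w) ^ CARD('n)) * F w \<partial>\<mu>)"
proof -
  have id [measurable]: "(\<lambda>x. x) \<in> measurable \<mu> borel"
    unfolding measurable_cong_sets[OF sets refl] by (intro measurable_restrict_space1) simp
  have sp: "space \<mu> = ball 0 1"
    using sets_eq_imp_space_eq[OF sets] by (simp add: space_restrict_space)
  have "emeasure (weighted_measure \<mu>) (space (weighted_measure \<mu>)) = (\<integral>\<^sup>+w. ennreal ((1 - norm w) ^ CARD('n)) \<partial>\<mu>)"
    by (simp add: weighted_measure_def emeasure_density cong: nn_integral_cong)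
  also have "\<dots> \<le> (\<integral>\<^sup>+w. ennreal ((1 - (norm w)\<^sup>2) ^ CARD('n)) \<partial>\<mu>)"
    using one_minus_square_bounds(1)
    by (intro nn_integral_mono ennreal_leI power_mono) (auto simp: sp less_imp_le)
  also note fin
  finally have "finite_measure (weighted_measure \<mu>)"
    by (intro finite_measureI) auto
  then show "ball_measure (weighted_measure \<mu>)"
    using sets by (intro ball_measure.intro ball_measure_axioms.intro) (simp_all add: weighted_measure_def)
  assume "F \<in> borel_measurable borel"
  then have [measurable]: "F \<in> borel_measurable \<mu>"
    using measurable_compose[OF id] by simp
  show "(\<integral>\<^sup>+w. F w \<partial>weighted_measure \<mu>) = (\<integral>\<^sup>+w. ennreal ((1 - norm w) ^ CARD('n)) * F w \<partial>\<mu>)"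
    unfolding weighted_measure_def by (intro nn_integral_density) measurable
qed

theorem theorem1:
  fixes \<mu> :: "(complex ^ 'n) measure" and p \<gamma> :: real
  assumes "CARD('n) > 1"
    and "1 < p" and "p < (2 * real CARD('n) - 1) / (2 * (real CARD('n) - 1))"
    and "0 \<le> \<gamma>" and "\<gamma> < 2 * real CARD('n)"
    and "sets \<mu> = sets (restrict_space borel (ball 0 1))"
    and "(\<integral>\<^sup>+w. ennreal ((1 - (norm w)\<^sup>2) ^ CARD('n)) \<partial>\<mu>) < \<infinity>"
  shows "(\<exists>K::real. \<forall>\<^sub>F r in at_left 1.
            sphere_mean p r (green_potential \<mu>) \<le> ennreal (K * (1 - r) powr (\<gamma> - real CARD('n))))
     \<longleftrightarrow> (\<exists>K::real. \<forall>\<delta>. 0 < \<delta> \<and> \<delta> < 1 \<longrightarrow>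
            epowr (\<integral>\<^sup>+\<xi>. epowr (emeasure (weighted_measure \<mu>) (carleson_region \<xi> \<delta>)) p \<partial>sphere_measure) (1 / p)
              \<le> ennreal (K * \<delta> powr \<gamma>))"
proof -
  define \<nu> where "\<nu> = weighted_measure \<mu>"
  interpret ball_measure \<nu>
    unfolding \<nu>_def using assms by (intro ball_measure_weighted_measure)
  note int_\<nu> = ball_measure_weighted_measure(2)[OF assms(6,7), folded \<nu>_def]
  have space_\<mu>: "space \<mu> = ball 0 1"
    using sets_eq_imp_space_eq[OF assms(6)] by (simp add: space_restrict_space)
  note p = assms(2)
  have p0: "0 < p" using p by simp
  obtain T where T: "0 \<le> T" "emeasure \<nu> (space \<nu>) = ennreal T"
    using emeasure_finite[of "space \<nu>"] by (cases "emeasure \<nu> (space \<nu>)") auto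
  \<comment> \<open>The trivial bound by the total mass, for radii about which the assumed estimate
    says nothing.\<close>
  have mass_T: "(\<integral>\<^sup>+\<xi>. epowr (mass \<xi> s) p \<partial>sphere_measure) \<le> ennreal (T powr p)" for s
  proof -
    have "(\<integral>\<^sup>+\<xi>. epowr (mass \<xi> s) p \<partial>sphere_measure) \<le> (\<integral>\<^sup>+\<xi>. epowr (ennreal T) p \<partial>(sphere_measure :: (complex ^ 'n) measure))"
      unfolding T(2)[symmetric] using p by (intro nn_integral_mono epowr_mono emeasure_space) auto
    also have "\<dots> = ennreal (T powr p)"
      using T by (simp add: epowr_ennreal sphere.emeasure_space_1)
    finally show ?thesis .
  qed
  show ?thesis
    unfolding \<nu>_def[symmetric]
  proof
    assume "\<exists>K::real. \<forall>\<^sub>F r in at_left 1.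
            sphere_mean p r (green_potential \<mu>) \<le> ennreal (K * (1 - r) powr (\<gamma> - real CARD('n)))"
    then obtain K b where b: "b < 1" and K: "\<And>r. b < r \<Longrightarrow> r < 1 \<Longrightarrow>
        sphere_mean p r (green_potential \<mu>) \<le> ennreal (K * (1 - r) powr (\<gamma> - real CARD('n)))"
      unfolding eventually_at_left_field by blast
    \<comment> \<open>The constant is made nonnegative because the calculation raises it to real
      powers.\<close>
    define K' where "K' = max K 0"
    \<comment> \<open>For \<delta> < d the assumed bound applies to r = 1 - \<delta>; the maximum
      keeps d <= 1 when b is negative.\<close>
    define d where "d = 1 - max b 0"
    have d: "0 < d" "d \<le> 1" using b by (auto simp: d_def)
    obtain c :: real where c: "0 < c"
      "\<And>\<delta> \<xi> (w :: complex ^ 'n). 0 < \<delta> \<Longrightarrow> \<delta> < 1 \<Longrightarrow> norm \<xi> = 1 \<Longrightarrow> w \<in> carleson_region \<xi> \<delta> \<Longrightarrow>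
      ennreal (c / \<delta> ^ CARD('n)) * ennreal ((1 - norm w) ^ CARD('n)) \<le> green ((1 - \<delta>) *\<^sub>R \<xi>) w"
      using green_lower_bound by blast
    \<comment> \<open>The second summand serves \<delta> >= d, where \<gamma> >= 0 makes \<delta>
      powr \<gamma> at least d powr \<gamma>.\<close>
    define L where "L = K' / c + T / d powr \<gamma>"
    have L: "0 \<le> K' / c" "0 \<le> T / d powr \<gamma>" "0 \<le> L"
      using c d T by (auto simp: K'_def L_def)
    have "(\<integral>\<^sup>+\<xi>. epowr (mass \<xi> \<delta>) p \<partial>sphere_measure) \<le> ennreal ((L * \<delta> powr \<gamma>) powr p)"
      if \<delta>: "0 < \<delta>" "\<delta> < 1" for \<delta>
    proof (cases "\<delta> < d")
      case True
      define e where "e = c / \<delta> ^ CARD('n)"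
      have e: "0 < e" using c \<delta> by (simp add: e_def)
      have pt: "ennreal e * mass \<xi> \<delta> \<le> green_potential \<mu> ((1 - \<delta>) *\<^sub>R \<xi>)" if \<xi>: "norm \<xi> = 1" for \<xi>
      proof -
        have "ennreal e * mass \<xi> \<delta> = (\<integral>\<^sup>+w. ennreal e * indicator (carleson_region \<xi> \<delta>) w \<partial>\<nu>)"
          by (simp add: nn_integral_cmult)
        also have "\<dots> = (\<integral>\<^sup>+w. ennreal ((1 - norm w) ^ CARD('n)) * (ennreal e * indicator (carleson_region \<xi> \<delta>) w) \<partial>\<mu>)"
          by (intro int_\<nu>) measurable
        also have "\<dots> \<le> (\<integral>\<^sup>+w. green ((1 - \<delta>) *\<^sub>R \<xi>) w \<partial>\<mu>)"
          using c(2)[OF \<delta> \<xi>] unfolding e_def by (intro nn_integral_mono) (auto simp: indicator_def mult.commute)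
        finally show ?thesis by (simp add: green_potential_def)
      qed
      have "ennreal (e powr p) * (\<integral>\<^sup>+\<xi>. epowr (mass \<xi> \<delta>) p \<partial>sphere_measure)
        = (\<integral>\<^sup>+\<xi>. epowr (ennreal e * mass \<xi> \<delta>) p \<partial>sphere_measure)"
        using e p by (subst nn_integral_epowr_cmult) auto
      also have "\<dots> \<le> (\<integral>\<^sup>+\<xi>. epowr (green_potential \<mu> ((1 - \<delta>) *\<^sub>R \<xi>)) p \<partial>sphere_measure)"
        using pt p by (intro nn_integral_mono epowr_mono) (auto simp: space_sphere_measure)
      also have "\<dots> \<le> ennreal ((K' * \<delta> powr (\<gamma> - real CARD('n))) powr p)"
      proof (subst epowr_root_le_iff[OF p0, symmetric])
        have "epowr (\<integral>\<^sup>+\<xi>. epowr (green_potential \<mu> ((1 - \<delta>) *\<^sub>R \<xi>)) p \<partial>sphere_measure) (1 / p)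
            \<le> ennreal (K * \<delta> powr (\<gamma> - real CARD('n)))"
          using K[of "1 - \<delta>"] True \<delta> by (simp add: sphere_mean_def d_def)
        also have "\<dots> \<le> ennreal (K' * \<delta> powr (\<gamma> - real CARD('n)))"
          by (intro ennreal_leI mult_right_mono) (auto simp: K'_def)
        finally show "epowr (\<integral>\<^sup>+\<xi>. epowr (green_potential \<mu> ((1 - \<delta>) *\<^sub>R \<xi>)) p \<partial>sphere_measure) (1 / p)
            \<le> ennreal (K' * \<delta> powr (\<gamma> - real CARD('n)))" .
      qed (simp add: K'_def)
      finally have "ennreal ((1 / e) powr p) * (ennreal (e powr p) * (\<integral>\<^sup>+\<xi>. epowr (mass \<xi> \<delta>) p \<partial>sphere_measure))
          \<le> ennreal ((1 / e) powr p) * ennreal ((K' * \<delta> powr (\<gamma> - real CARD('n))) powr p)"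
        by (intro mult_left_mono) auto
      also have "\<dots> = ennreal ((1 / e * (K' * \<delta> powr (\<gamma> - real CARD('n)))) powr p)"
        using e by (subst powr_mult [of "1 / e"]) (auto simp: K'_def ennreal_mult)
      also have "1 / e * (K' * \<delta> powr (\<gamma> - real CARD('n))) = K' / c * \<delta> powr \<gamma>"
        using \<delta> c by (simp add: e_def powr_diff powr_realpow)
      also have "ennreal ((K' / c * \<delta> powr \<gamma>) powr p) \<le> ennreal ((L * \<delta> powr \<gamma>) powr p)"
        using L p by (intro ennreal_leI powr_mono2 mult_right_mono mult_nonneg_nonneg) (auto simp: L_def)
      also have "ennreal ((1 / e) powr p) * (ennreal (e powr p) * (\<integral>\<^sup>+\<xi>. epowr (mass \<xi> \<delta>) p \<partial>sphere_measure))
          = (\<integral>\<^sup>+\<xi>. epowr (mass \<xi> \<delta>) p \<partial>sphere_measure)"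
      proof -
        have "ennreal ((1 / e) powr p) * ennreal (e powr p) = ennreal (((1 / e) * e) powr p)"
          using e by (subst powr_mult) (auto simp: ennreal_mult)
        then show ?thesis using e by (simp add: mult.assoc[symmetric])
      qed
      finally show ?thesis .
    next
      case False
      have "T = T / d powr \<gamma> * d powr \<gamma>" using d by simp
      also have "\<dots> \<le> T / d powr \<gamma> * \<delta> powr \<gamma>"
        using False d L assms(4) by (intro mult_left_mono powr_mono2) auto
      also have "\<dots> \<le> L * \<delta> powr \<gamma>"
        using L by (intro mult_right_mono) (auto simp: L_def)
      finally have "ennreal (T powr p) \<le> ennreal ((L * \<delta> powr \<gamma>) powr p)"
        using T p by (intro ennreal_leI powr_mono2) auto
      with mass_T[of \<delta>] show ?thesis by (rule order_trans)
    qed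
    then show "\<exists>K::real. \<forall>\<delta>. 0 < \<delta> \<and> \<delta> < 1 \<longrightarrow>
            epowr (\<integral>\<^sup>+\<xi>. epowr (mass \<xi> \<delta>) p \<partial>sphere_measure) (1 / p) \<le> ennreal (K * \<delta> powr \<gamma>)"
      using L p0 by (intro exI[of _ L] allI impI) (subst epowr_root_le_iff, auto)
  next
    assume "\<exists>K::real. \<forall>\<delta>. 0 < \<delta> \<and> \<delta> < 1 \<longrightarrow>
            epowr (\<integral>\<^sup>+\<xi>. epowr (mass \<xi> \<delta>) p \<partial>sphere_measure) (1 / p) \<le> ennreal (K * \<delta> powr \<gamma>)"
    then obtain K1 where K1: "\<And>\<delta>. 0 < \<delta> \<Longrightarrow> \<delta> < 1 \<Longrightarrow>
        epowr (\<integral>\<^sup>+\<xi>. epowr (mass \<xi> \<delta>) p \<partial>sphere_measure) (1 / p) \<le> ennreal (K1 * \<delta> powr \<gamma>)"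
      by blast
    define K where "K = max K1 T"
    have K0: "0 \<le> K" using T by (auto simp: K_def)
    \<comment> \<open>Extension to all radii: for s >= 1 the total mass T <= K suffices, because s
      powr \<gamma> >= 1. The far sum uses arbitrarily large radii, the near part radius 252
      \<delta>.\<close>
    have growth: "(\<integral>\<^sup>+\<xi>. epowr (mass \<xi> s) p \<partial>sphere_measure) \<le> ennreal ((K * s powr \<gamma>) powr p)"
      if s: "0 < s" for s
    proof (cases "s < 1")
      case True
      have "epowr (\<integral>\<^sup>+\<xi>. epowr (mass \<xi> s) p \<partial>sphere_measure) (1 / p) \<le> ennreal (K1 * s powr \<gamma>)"
        using s True by (rule K1)
      also have "\<dots> \<le> ennreal (K * s powr \<gamma>)"
        by (intro ennreal_leI mult_right_mono) (auto simp: K_def)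
      finally show ?thesis
        using K0 p0 by (subst (asm) epowr_root_le_iff) auto
    next
      case False
      have "T * 1 \<le> K * s powr \<gamma>"
        using False assms(4) K0 T by (intro mult_mono ge_one_powr_ge_zero) (auto simp: K_def)
      then have "ennreal (T powr p) \<le> ennreal ((K * s powr \<gamma>) powr p)"
        using T p by (intro ennreal_leI powr_mono2) auto
      with mass_T[of s] show ?thesis by (rule order_trans)
    qed
    obtain C1 where C1: "0 \<le> C1" "\<And>\<delta>. 0 < \<delta> \<Longrightarrow> \<delta> \<le> 1 \<Longrightarrow>
        (\<integral>\<^sup>+\<xi>. epowr (\<integral>\<^sup>+w. near_kernel \<delta> \<xi> w \<partial>\<nu>) p \<partial>sphere_measure) \<le> ennreal ((C1 * \<delta> powr \<gamma>) powr p)"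
      using near_estimate[OF assms(1,2,3) K0 growth] by blast
    define far where "far = (\<lambda>\<delta> \<xi>. \<Sum>k. ennreal (1 / (2 ^ k * \<delta>) ^ (2 * CARD('n))) * mass \<xi> (2 ^ (k + 2) * \<delta>))"
    obtain C2 where C2: "0 \<le> C2" "\<And>\<delta>. 0 < \<delta> \<Longrightarrow>
        (\<integral>\<^sup>+\<xi>. epowr (far \<delta> \<xi>) p \<partial>sphere_measure) \<le> ennreal ((C2 * \<delta> powr (\<gamma> - 2 * real CARD('n))) powr p)"
      unfolding far_def using far_estimate[OF p assms(5) K0 growth] by blast
    obtain C :: real where C: "0 < C"
      "\<And>r \<xi> (w :: complex ^ 'n). 1 / 2 \<le> r \<Longrightarrow> r < 1 \<Longrightarrow> norm \<xi> = 1 \<Longrightarrow> norm w < 1 \<Longrightarrow>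
      green (r *\<^sub>R \<xi>) w \<le> ennreal ((1 - norm w) ^ CARD('n)) *
        (ennreal (C / (1 - r) ^ CARD('n)) * near_kernel (1 - r) \<xi> w
        + ennreal (C * (1 - r) ^ CARD('n)) * (\<Sum>k. ennreal (1 / (2 ^ k * (1 - r)) ^ (2 * CARD('n)))
             * indicator (carleson_region \<xi> (2 ^ (k + 2) * (1 - r))) w))"
      using green_upper_bound[OF assms(1)] by blast
    \<comment> \<open>Combines the two constants through (x + y)^p <= 2^p (x^p + y^p), which stands
      in for the triangle inequality in the mean.\<close>
    define L where "L = (2 powr p * ((C * C1) powr p + (C * C2) powr p)) powr (1 / p)"
    have L: "0 \<le> L" "L powr p = 2 powr p * ((C * C1) powr p + (C * C2) powr p)"
      using p by (simp_all add: L_def powr_powr)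
    have main: "sphere_mean p r (green_potential \<mu>) \<le> ennreal (L * (1 - r) powr (\<gamma> - real CARD('n)))"
      if r: "1 / 2 \<le> r" "r < 1" for r
    proof -
      define \<delta> where "\<delta> = 1 - r"
      have \<delta>: "0 < \<delta>" "\<delta> \<le> 1" using r by (auto simp: \<delta>_def)
      define near where "near = (\<lambda>\<xi>. \<integral>\<^sup>+w. near_kernel \<delta> \<xi> w \<partial>\<nu>)"
      define a where "a = C / \<delta> ^ CARD('n)"
      define b where "b = C * \<delta> ^ CARD('n)"
      have ab: "0 \<le> a" "0 \<le> b" using C \<delta> by (auto simp: a_def b_def)
      have [measurable]: "near \<in> borel_measurable sphere_measure"
        unfolding near_def by (rule borel_measurable_nn_integral) (simp add: case_prod_unfold)
      have [measurable]: "far \<delta> \<in> borel_measurable sphere_measure"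
        unfolding far_def by measurable
      have pt: "green_potential \<mu> (r *\<^sub>R \<xi>) \<le> ennreal a * near \<xi> + ennreal b * far \<delta> \<xi>"
        if \<xi>: "norm \<xi> = 1" for \<xi>
      proof -
        let ?S = "\<lambda>w. \<Sum>k. ennreal (1 / (2 ^ k * \<delta>) ^ (2 * CARD('n))) * indicator (carleson_region \<xi> (2 ^ (k + 2) * \<delta>)) w"
        have "green_potential \<mu> (r *\<^sub>R \<xi>) \<le> (\<integral>\<^sup>+w. ennreal ((1 - norm w) ^ CARD('n)) *
            (ennreal a * near_kernel \<delta> \<xi> w + ennreal b * ?S w) \<partial>\<mu>)"
          unfolding green_potential_def a_def b_def \<delta>_def
          using C(2)[OF r \<xi>] by (intro nn_integral_mono) (auto simp: space_\<mu>)
        also have "\<dots> = (\<integral>\<^sup>+w. ennreal a * near_kernel \<delta> \<xi> w + ennreal b * ?S w \<partial>\<nu>)"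
          by (intro int_\<nu>[symmetric]) measurable
        also have "\<dots> = ennreal a * near \<xi> + ennreal b * (\<integral>\<^sup>+w. ?S w \<partial>\<nu>)"
          unfolding near_def by (simp add: nn_integral_add nn_integral_cmult)
        also have "(\<integral>\<^sup>+w. ?S w \<partial>\<nu>) = far \<delta> \<xi>"
          by (simp add: nn_integral_suminf nn_integral_cmult far_def)
        finally show ?thesis .
      qed
      have "(\<integral>\<^sup>+\<xi>. epowr (green_potential \<mu> (r *\<^sub>R \<xi>)) p \<partial>sphere_measure)
        \<le> (\<integral>\<^sup>+\<xi>. ennreal (2 powr p) * (epowr (ennreal a * near \<xi>) p + epowr (ennreal b * far \<delta> \<xi>) p) \<partial>sphere_measure)"
      proof (rule nn_integral_mono)
        fix \<xi> assume "\<xi> \<in> space (sphere_measure :: (complex ^ 'n) measure)"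
        then have "norm \<xi> = 1" by (simp add: space_sphere_measure)
        then have "epowr (green_potential \<mu> (r *\<^sub>R \<xi>)) p \<le> epowr (ennreal a * near \<xi> + ennreal b * far \<delta> \<xi>) p"
          using p by (intro epowr_mono pt) auto
        also note epowr_add_le[OF p0]
        finally show "epowr (green_potential \<mu> (r *\<^sub>R \<xi>)) p
          \<le> ennreal (2 powr p) * (epowr (ennreal a * near \<xi>) p + epowr (ennreal b * far \<delta> \<xi>) p)" .
      qed
      also have "\<dots> = ennreal (2 powr p) * (ennreal (a powr p) * (\<integral>\<^sup>+\<xi>. epowr (near \<xi>) p \<partial>sphere_measure)
          + ennreal (b powr p) * (\<integral>\<^sup>+\<xi>. epowr (far \<delta> \<xi>) p \<partial>sphere_measure))"
        using p0 ab by (simp add: nn_integral_add nn_integral_cmult nn_integral_epowr_cmult)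
      also have "\<dots> \<le> ennreal (2 powr p) * (ennreal (a powr p) * ennreal ((C1 * \<delta> powr \<gamma>) powr p)
          + ennreal (b powr p) * ennreal ((C2 * \<delta> powr (\<gamma> - 2 * real CARD('n))) powr p))"
        unfolding near_def using \<delta> by (intro mult_left_mono add_mono C1(2) C2(2)) auto
      also have "\<dots> = ennreal (2 powr p * ((a * (C1 * \<delta> powr \<gamma>)) powr p
          + (b * (C2 * \<delta> powr (\<gamma> - 2 * real CARD('n)))) powr p))"
        using ab C1(1) C2(1) by (simp add: powr_mult ennreal_mult)
      \<comment> \<open>Both parts scale alike: \<delta>^(-n) times \<delta> powr \<gamma> here, and
        \<delta>^n times \<delta> powr (\<gamma> - 2 n) next.\<close>
      also have "a * (C1 * \<delta> powr \<gamma>) = C * C1 * \<delta> powr (\<gamma> - real CARD('n))"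
        using \<delta> by (simp add: a_def powr_diff powr_realpow)
      also have "b * (C2 * \<delta> powr (\<gamma> - 2 * real CARD('n))) = C * C2 * \<delta> powr (\<gamma> - real CARD('n))"
      proof -
        have "\<delta> ^ CARD('n) * \<delta> powr (\<gamma> - 2 * real CARD('n)) = \<delta> powr (\<gamma> - real CARD('n))"
          using \<delta> by (subst powr_realpow[symmetric], simp, subst powr_add[symmetric]) (simp add: algebra_simps)
        then show ?thesis by (simp add: b_def mult_ac)
      qed
      also have "2 powr p * ((C * C1 * \<delta> powr (\<gamma> - real CARD('n))) powr p + (C * C2 * \<delta> powr (\<gamma> - real CARD('n))) powr p)
        = (L * \<delta> powr (\<gamma> - real CARD('n))) powr p"
      proof -
        have "(C * C1 * x) powr p = (C * C1) powr p * x powr p" "(C * C2 * x) powr p = (C * C2) powr p * x powr p"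
          "(L * x) powr p = L powr p * x powr p" if "0 \<le> x" for x
          using that L(1) C(1) C1(1) C2(1) by (intro powr_mult; simp)+
        then show ?thesis
          by (simp add: L(2) distrib_left distrib_right mult.assoc)
      qed
      finally show ?thesis
        unfolding sphere_mean_def \<delta>_def[symmetric] using L(1) p0 by (subst epowr_root_le_iff) auto
    qed
    have "\<forall>\<^sub>F r in at_left 1. sphere_mean p r (green_potential \<mu>) \<le> ennreal (L * (1 - r) powr (\<gamma> - real CARD('n)))"
      unfolding eventually_at_left_field using main by (intro exI[of _ "1 / 2"]) auto
    then show "\<exists>K::real. \<forall>\<^sub>F r in at_left 1.
            sphere_mean p r (green_potential \<mu>) \<le> ennreal (K * (1 - r) powr (\<gamma> - real CARD('n)))" ..
  qed
qed

end
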